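(* Consider the problem of deletion robust (possibly non-monotone) submodular maximization subject to a matroid constraint of rank $k$ with deletion parameter $d$. Let $\textsc{Alg}$ be any (centralized) algorithm which, given a set of elements, the function $f$ and the matroid $\mathcal{M}$, returns an independent subset of the given set whose expected value is at least $1/\beta$ times the maximum value of an independent subset of the given set. Then for every $\varepsilon \in (0, 1/5)$, the two-phase Centralized Algorithm described in the context (using $\textsc{Alg}$ in Phase II) is, in expectation, a $(2 + \beta + O(\varepsilon))$-approximation algorithm for this problem, and its summary has size $O\!\left(\frac{k+d}{\varepsilon^2}\log \frac{k}{\varepsilon}\right)$.
   Context: Setting: $V$ is a finite ground set, $f : 2^V \to \mathbb{R}_{\ge 0}$ is a normalized ($f(\emptyset)=0$) submodular function accessed through a value oracle (not necessarily monotone), and $\mathcal{M} \subseteq 2^V$ is a matroid of rank $k$. Write $f(X \mid Y) = f(X \cup Y) - f(Y)$ and $f(e\mid Y)=f(\{e\}\mid Y)$. Deletion robust model: in Phase I the algorithm receives $V$ and a parameter $d$ and outputs a (possibly random) summary $W \subseteq V$; an adversary, who may know the algorithm but not its random bits, chooses $D \subseteq V$ with $|D| \le d$; in Phase II the algorithm receives $D$ and its Phase I output and returns $S_D \subseteq W \setminus D$ with $S_D \in \mathcal{M}$. The algorithm is an $\alpha$-approximation if for every $D \subseteq V$ with $|D| \le d$, $\max\{f(R) : R \subseteq V \setminus D, R \in \mathcal{M}\} \le \alpha \cdot \mathbb{E}[f(S_D)]$, the expectation being over the algorithm's randomness. The summary size is $|W|$. Centralized Algorithm, Phase I (input $\varepsilon$,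 $d$): let $\Delta$ be the $(d+1)$-th largest value in $\{f(e): e\in V\}$, let $V_d$ be the $d$ elements of largest value, set $V \leftarrow V \setminus V_d$ and $A \leftarrow \emptyset$. Let $T = \{(1+\varepsilon)^i : i \in \mathbb{Z},\ \varepsilon\Delta/((1+\varepsilon)k) < (1+\varepsilon)^i \le \Delta\}$. For each $\tau \in T$ in decreasing order: set $B_\tau = \{e \in V : A \cup\{e\} \in \mathcal{M},\ f(e\mid A) \ge \tau\}$; while $|B_\tau| \ge (k+d)/\varepsilon$, sample $e$ independently and uniformly at random from $B_\tau$, remove $e$ from $V$, add $e$ to $A$, and recompute $B_\tau$ by the same formula; after the while loop remove $B_\tau$ from $V$. Finally set $B = V_d \cup \bigcup_{\tau \in T} B_\tau$ and output $A, B$ (the summary is $W = A \cup B$). Phase II (input $A$, $B$, $D$): set $A' = A \setminus D$, $B' = B\setminus D$, $\tilde S = \textsc{Alg}(A' \cup B')$, and return whichever of $A'$, $\tilde S$ has larger $f$-value.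
   Formalization: Phase I is run on the elements e with {e} in M (all of V if the matroid has no loops), since a loop of large value would make the claim false as stated; the constant in O(ε) may depend on β, since a constant independent of β is impossible. *)

theory Defs
  imports "HOL-Probability.Probability"
begin

definition submodular_on :: "'a set \<Rightarrow> ('a set \<Rightarrow> real) \<Rightarrow> bool" where
  "submodular_on V f \<longleftrightarrow>
     (\<forall>X Y. X \<subseteq> V \<longrightarrow> Y \<subseteq> V \<longrightarrow> f (X \<union> Y) + f (X \<inter> Y) \<le> f X + f Y)"

definition marginal :: "('a set \<Rightarrow> real) \<Rightarrow> 'a set \<Rightarrow> 'a set \<Rightarrow> real" where
  "marginal f X Y = f (X \<union> Y) - f Y"

definition matroid :: "'a set \<Rightarrow> 'a set set \<Rightarrow> bool" where
  "matroid V M \<longleftrightarrow> finite V \<and> M \<subseteq> Pow V \<and> {} \<in> M \<and>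
     (\<forall>X Y. X \<in> M \<longrightarrow> Y \<subseteq> X \<longrightarrow> Y \<in> M) \<and>
     (\<forall>X Y. X \<in> M \<longrightarrow> Y \<in> M \<longrightarrow> card X < card Y \<longrightarrow> (\<exists>e\<in>Y - X. insert e X \<in> M))"

definition matroid_rank :: "'a set set \<Rightarrow> nat" where
  "matroid_rank M = Max (card ` M)"

definition matroid_submod_instance :: "'a set \<Rightarrow> ('a set \<Rightarrow> real) \<Rightarrow> 'a set set \<Rightarrow> bool" where
  "matroid_submod_instance V f M \<longleftrightarrow> matroid V M \<and> submodular_on V f \<and>
     f {} = 0 \<and> (\<forall>X. X \<subseteq> V \<longrightarrow> 0 \<le> f X)"

definition opt_value :: "('a set \<Rightarrow> real) \<Rightarrow> 'a set set \<Rightarrow> 'a set \<Rightarrow> real" where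
  "opt_value f M X = Max (f ` {R \<in> M. R \<subseteq> X})"

text \<open>A randomised algorithm receives the available elements, the objective and the matroid, and
  returns the distribution of its output.\<close>

type_synonym 'a centralized_alg = "'a set \<Rightarrow> ('a set \<Rightarrow> real) \<Rightarrow> 'a set set \<Rightarrow> 'a set pmf"

definition centralized_approx :: "real \<Rightarrow> 'a centralized_alg \<Rightarrow> bool" where
  "centralized_approx \<beta> Alg \<longleftrightarrow>
     (\<forall>V f M X. matroid_submod_instance V f M \<longrightarrow> X \<subseteq> V \<longrightarrow>
        (\<forall>S\<in>set_pmf (Alg X f M). S \<subseteq> X \<and> S \<in> M) \<and>
        1 / \<beta> * opt_value f M X \<le> measure_pmf.expectation (Alg X f M) f)"

text \<open>A two-phase algorithm is given by the distribution of its first-phase output \<open>(A, B)\<close>, with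
  summary \<open>A \<union> B\<close>, and by the distribution of its final output for given \<open>A\<close>, \<open>B\<close> and \<open>D\<close>.
  Since \<open>D\<close> is quantified outside the expectation, the adversary does not see the random bits.\<close>

definition deletion_robust_approx ::
  "'a set \<Rightarrow> ('a set \<Rightarrow> real) \<Rightarrow> 'a set set \<Rightarrow> nat \<Rightarrow> real \<Rightarrow>
   ('a set \<times> 'a set) pmf \<Rightarrow> ('a set \<Rightarrow> 'a set \<Rightarrow> 'a set \<Rightarrow> 'a set pmf) \<Rightarrow> bool" where
  "deletion_robust_approx V f M d \<alpha> P1 P2 \<longleftrightarrow>
     (\<forall>(A, B)\<in>set_pmf P1. A \<union> B \<subseteq> V) \<and>
     (\<forall>D. D \<subseteq> V \<longrightarrow> card D \<le> d \<longrightarrow>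
        (\<forall>(A, B)\<in>set_pmf P1. \<forall>S\<in>set_pmf (P2 A B D). S \<subseteq> (A \<union> B) - D \<and> S \<in> M) \<and>
        opt_value f M (V - D) \<le>
          \<alpha> * measure_pmf.expectation (bind_pmf P1 (\<lambda>(A, B). P2 A B D)) f)"

text \<open>The \<open>(d+1)\<close>-th largest singleton value, counted with multiplicity; it is \<open>0\<close> if there are at most \<open>d\<close> elements.\<close>

definition nth_largest_value :: "('a set \<Rightarrow> real) \<Rightarrow> 'a set \<Rightarrow> nat \<Rightarrow> real" where
  "nth_largest_value f V d =
     (if d < card V
      then rev (sorted_list_of_multiset (image_mset (\<lambda>e. f {e}) (mset_set V))) ! d
      else 0)"

text \<open>\<open>Vd\<close> is a possible choice, with arbitrary tie-breaking, of the \<open>d\<close> elements of largest value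
  (all elements, if there are at most \<open>d\<close> of them).\<close>

definition top_elements :: "('a set \<Rightarrow> real) \<Rightarrow> 'a set \<Rightarrow> nat \<Rightarrow> 'a set \<Rightarrow> bool" where
  "top_elements f V d Vd \<longleftrightarrow> Vd \<subseteq> V \<and> card Vd = min d (card V) \<and>
     (\<forall>e\<in>Vd. \<forall>e'\<in>V - Vd. f {e'} \<le> f {e})"

definition thresholds :: "real \<Rightarrow> nat \<Rightarrow> real \<Rightarrow> real set" where
  "thresholds \<epsilon> k \<Delta> =
     {(1 + \<epsilon>) powi i | i :: int.
        \<epsilon> * \<Delta> / ((1 + \<epsilon>) * real k) < (1 + \<epsilon>) powi i \<and> (1 + \<epsilon>) powi i \<le> \<Delta>}"

definition candidates ::
  "('a set \<Rightarrow> real) \<Rightarrow> 'a set set \<Rightarrow> real \<Rightarrow> 'a set \<Rightarrow> 'a set \<Rightarrow> 'a set" where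
  "candidates f M \<tau> A U = {e \<in> U. A \<union> {e} \<in> M \<and> marginal f {e} A \<ge> \<tau>}"

text \<open>The while loop for one threshold, on the current solution \<open>A\<close> and the remaining elements \<open>U\<close>.
  The guards \<open>finite U\<close> and \<open>candidates f M \<tau> A U \<noteq> {}\<close> only matter for termination: on a finite
  ground set with \<open>\<epsilon> > 0\<close> and \<open>k + d > 0\<close> they follow from the size test.\<close>

function sample_loop ::
  "('a set \<Rightarrow> real) \<Rightarrow> 'a set set \<Rightarrow> nat \<Rightarrow> nat \<Rightarrow> real \<Rightarrow> real \<Rightarrow> 'a set \<Rightarrow> 'a set \<Rightarrow>
   ('a set \<times> 'a set) pmf" where
  "sample_loop f M k d \<epsilon> \<tau> A U =
     (if finite U \<and> candidates f M \<tau> A U \<noteq> {} \<and>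
         real (card (candidates f M \<tau> A U)) \<ge> (real k + real d) / \<epsilon>
      then bind_pmf (pmf_of_set (candidates f M \<tau> A U))
             (\<lambda>e. sample_loop f M k d \<epsilon> \<tau> (A \<union> {e}) (U - {e}))
      else return_pmf (A, U))"
  by pat_completeness auto

termination
proof (relation "Wellfounded.measure (\<lambda>(f, M, k, d, \<epsilon>, \<tau>, A, U). card U)", goal_cases)
  case 1
  show ?case by simp
next
  case (2 f M k d \<epsilon> \<tau> A U e)
  then have "finite (candidates f M \<tau> A U)"
    by (simp add: candidates_def)
  with 2 have "e \<in> U"
    by (auto simp: candidates_def)
  with 2 show ?case
    by (simp add: card_Diff1_less del: card_Diff_insert)
qed

declare sample_loop.simps [simp del]

fun threshold_loop ::
  "('a set \<Rightarrow> real) \<Rightarrow> 'a set set \<Rightarrow> nat \<Rightarrow> nat \<Rightarrow> real \<Rightarrow> real list \<Rightarrow> 'a set \<Rightarrow> 'a set \<Rightarrow> 'a set \<Rightarrow>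
   ('a set \<times> 'a set) pmf" where
  "threshold_loop f M k d \<epsilon> [] A B U = return_pmf (A, B)"
| "threshold_loop f M k d \<epsilon> (\<tau> # \<tau>s) A B U =
     bind_pmf (sample_loop f M k d \<epsilon> \<tau> A U)
       (\<lambda>(A', U'). let B\<tau> = candidates f M \<tau> A' U'
          in threshold_loop f M k d \<epsilon> \<tau>s A' (B \<union> B\<tau>) (U' - B\<tau>))"

definition phase1 ::
  "real \<Rightarrow> nat \<Rightarrow> nat \<Rightarrow> 'a set \<Rightarrow> ('a set \<Rightarrow> real) \<Rightarrow> 'a set set \<Rightarrow> 'a set \<Rightarrow>
   ('a set \<times> 'a set) pmf" where
  "phase1 \<epsilon> k d V f M Vd =
     threshold_loop f M k d \<epsilon>
       (rev (sorted_list_of_set (thresholds \<epsilon> k (nth_largest_value f V d)))) {} Vd (V - Vd)"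

definition phase2 ::
  "'a centralized_alg \<Rightarrow> ('a set \<Rightarrow> real) \<Rightarrow> 'a set set \<Rightarrow> 'a set \<Rightarrow> 'a set \<Rightarrow> 'a set \<Rightarrow> 'a set pmf"
  where
  "phase2 Alg f M A B D =
     map_pmf (\<lambda>S. if f (A - D) \<ge> f S then A - D else S) (Alg ((A - D) \<union> (B - D)) f M)"

text \<open>The elements that can be part of a solution. Phase I has to be run on these: a loop of large
  value would raise the \<open>(d+1)\<close>-th largest value above the optimum, and the thresholds would then
  miss all useful elements.\<close>

definition nonloops :: "'a set \<Rightarrow> 'a set set \<Rightarrow> 'a set" where
  "nonloops V M = {e \<in> V. {e} \<in> M}"

end

theory Submission
  imports Defs
begin

text \<open>
  Let \<open>R\<close> be an optimal independent set in \<open>V - D\<close>, and for the random output \<open>(A, B)\<close> of the first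
  phase let \<open>s\<close> be the sum over \<open>A\<close> of the thresholds at which its elements were sampled.
  An element is sampled at threshold \<open>\<tau>\<close> only if its marginal lies in \<open>[\<tau>, (1 + \<epsilon>) * \<tau>]\<close>, so
  \<open>f A \<le> (1 + \<epsilon>) * s\<close>; since every sample is deleted with probability at most \<open>\<epsilon>\<close>,
  the expectation of \<open>f (A - D)\<close> is at least \<open>1 - \<epsilon>\<close> times that of \<open>s\<close>. The elements of \<open>R\<close> outside
  \<open>A \<union> B\<close> either have a marginal below the smallest threshold, losing at most \<open>\<epsilon>\<close> times the optimum
  altogether, or became dependent on \<open>A\<close>; as at most \<open>card A\<close> of them are dependent on \<open>A\<close> at any
  time and thresholds decrease, their marginals sum to at most \<open>(1 + \<epsilon>) * s\<close>. Hence
  \<open>f (A \<union> R) \<le> f A + f (R \<inter> B) + (1 + \<epsilon>) * s + \<epsilon> * opt\<close>, where the second phase recovers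
  \<open>f (R \<inter> B)\<close> up to the factor \<open>\<beta>\<close>. Finally, at most \<open>k\<close> elements are sampled, each uniformly from at
  least \<open>(k + d) / \<epsilon>\<close> candidates, so for non-monotone \<open>f\<close> the expectation of \<open>f (A \<union> R)\<close> is still at least
  \<open>(1 - \<epsilon>) * f R\<close>.
\<close>

section \<open>Expectations over finitely supported distributions\<close>

lemma expectation_bind_pmf_of_set_real:
  fixes h :: "'b \<Rightarrow> real"
  assumes "finite A" "A \<noteq> {}" "\<And>x. x \<in> A \<Longrightarrow> finite (set_pmf (p x))"
  shows "measure_pmf.expectation (bind_pmf (pmf_of_set A) p) h =
    (\<Sum>x\<in>A. measure_pmf.expectation (p x) h) / card A"
  using assms
  by (simp add: pmf_expectation_bind_pmf_of_set sum_distrib_left divide_inverse mult.commute)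

lemma expectation_bind_finite:
  fixes h :: "'b \<Rightarrow> real"
  assumes "finite (set_pmf p)" "\<And>x. x \<in> set_pmf p \<Longrightarrow> finite (set_pmf (g x))"
  shows "measure_pmf.expectation (bind_pmf p g) h =
    measure_pmf.expectation p (\<lambda>x. measure_pmf.expectation (g x) h)"
proof -
  have "measure_pmf.expectation (bind_pmf p g) h =
      (\<Sum>x\<in>set_pmf p. pmf p x *\<^sub>R measure_pmf.expectation (g x) h)"
    by (rule pmf_expectation_bind) (use assms in auto)
  also have "\<dots> = measure_pmf.expectation p (\<lambda>x. measure_pmf.expectation (g x) h)"
    by (subst integral_measure_pmf[OF assms(1)]) auto
  finally show ?thesis .
qed

lemma expectation_mono_finite:
  fixes g h :: "'b \<Rightarrow> real"
  assumes "finite (set_pmf p)" "\<And>x. x \<in> set_pmf p \<Longrightarrow> g x \<le> h x"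
  shows "measure_pmf.expectation p g \<le> measure_pmf.expectation p h"
  using assms by (intro integral_mono_AE integrable_measure_pmf_finite) (auto simp: AE_measure_pmf_iff)

lemma le_expectation_finite:
  fixes h :: "'b \<Rightarrow> real"
  assumes "finite (set_pmf p)" "\<And>x. x \<in> set_pmf p \<Longrightarrow> c \<le> h x"
  shows "c \<le> measure_pmf.expectation p h"
  using expectation_mono_finite[OF assms(1), of "\<lambda>_. c" h] assms(2) by simp

section \<open>Support of the loops\<close>

lemma candidates_subset: "candidates f M \<tau> A U \<subseteq> U"
  by (auto simp: candidates_def)

lemma finite_candidates: "finite U \<Longrightarrow> finite (candidates f M \<tau> A U)"
  by (auto simp: candidates_def)

lemma set_pmf_sample_loop:
  assumes "(A', U') \<in> set_pmf (sample_loop f M k d \<epsilon> \<tau> A U)"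
  shows "(A \<in> M \<longrightarrow> A' \<in> M) \<and> A' \<union> U' = A \<union> U \<and> U' \<subseteq> U"
  using assms
proof (induction f M k d \<epsilon> \<tau> A U rule: sample_loop.induct)
  case (1 f M k d \<epsilon> \<tau> A U)
  let ?C = "candidates f M \<tau> A U"
  show ?case
  proof (cases "finite U \<and> ?C \<noteq> {} \<and> real (card ?C) \<ge> (real k + real d) / \<epsilon>")
    case True
    then obtain e where e: "e \<in> set_pmf (pmf_of_set ?C)"
      and s: "(A', U') \<in> set_pmf (sample_loop f M k d \<epsilon> \<tau> (A \<union> {e}) (U - {e}))"
      using "1.prems" by (subst (asm) sample_loop.simps) auto
    have "A \<union> {e} \<in> M" "e \<in> U"
      using e True by (auto simp: finite_candidates candidates_def)
    with "1.IH"[OF True e s] show ?thesis by auto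
  next
    case False
    then show ?thesis
      using "1.prems" by (subst (asm) sample_loop.simps) (auto split: if_splits)
  qed
qed

lemma card_candidates_sample_loop:
  assumes "(A', U') \<in> set_pmf (sample_loop f M k d \<epsilon> \<tau> A U)"
    and "finite U" "0 < real k + real d" "0 < \<epsilon>"
  shows "real (card (candidates f M \<tau> A' U')) \<le> (real k + real d) / \<epsilon>"
  using assms
proof (induction f M k d \<epsilon> \<tau> A U rule: sample_loop.induct)
  case (1 f M k d \<epsilon> \<tau> A U)
  let ?C = "candidates f M \<tau> A U"
  show ?case
  proof (cases "finite U \<and> ?C \<noteq> {} \<and> real (card ?C) \<ge> (real k + real d) / \<epsilon>")
    case True
    then obtain e where e: "e \<in> set_pmf (pmf_of_set ?C)"
      and s: "(A', U') \<in> set_pmf (sample_loop f M k d \<epsilon> \<tau> (A \<union> {e}) (U - {e}))"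
      using "1.prems" by (subst (asm) sample_loop.simps) auto
    with "1.IH"[OF True e s] "1.prems" show ?thesis by auto
  next
    case False
    then have "A' = A" "U' = U"
      using "1.prems"(1) by (subst (asm) sample_loop.simps; auto split: if_splits)+
    \<comment> \<open>The loop also stops when there are no candidates; their number 0 is below the
      bound because the bound is nonnegative.\<close>
    moreover have "0 \<le> (real k + real d) / \<epsilon>" using "1.prems" by simp
    ultimately show ?thesis using False "1.prems" by (cases "?C = {}") auto
  qed
qed

lemma finite_set_pmf_sample_loop:
  assumes "finite U"
  shows "finite (set_pmf (sample_loop f M k d \<epsilon> \<tau> A U))"
  using assms
proof (induction f M k d \<epsilon> \<tau> A U rule: sample_loop.induct)
  case (1 f M k d \<epsilon> \<tau> A U)
  then show ?case
    by (subst sample_loop.simps) (auto simp: set_pmf_of_set finite_candidates)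
qed

lemma finite_set_pmf_threshold_loop:
  assumes "finite U"
  shows "finite (set_pmf (threshold_loop f M k d \<epsilon> l A B U))"
  using assms
proof (induction l arbitrary: A B U)
  case (Cons \<tau> l)
  have "finite U'" if "(A', U') \<in> set_pmf (sample_loop f M k d \<epsilon> \<tau> A U)" for A' U'
    using set_pmf_sample_loop[OF that] Cons.prems finite_subset by blast
  then show ?case
    using Cons by (auto simp: Let_def intro!: finite_set_pmf_sample_loop)
qed auto

lemma set_pmf_threshold_loop:
  assumes "(A', B') \<in> set_pmf (threshold_loop f M k d \<epsilon> l A B U)"
  shows "(A \<in> M \<longrightarrow> A' \<in> M) \<and> A' \<union> B' \<subseteq> A \<union> B \<union> U"
  using assms
proof (induction l arbitrary: A B U)
  case (Cons \<tau> l)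
  obtain A1 U1 where 1: "(A1, U1) \<in> set_pmf (sample_loop f M k d \<epsilon> \<tau> A U)"
    and 2: "(A', B') \<in> set_pmf (threshold_loop f M k d \<epsilon> l A1 (B \<union> candidates f M \<tau> A1 U1)
      (U1 - candidates f M \<tau> A1 U1))"
    using Cons.prems by (auto simp: Let_def)
  show ?case
    using Cons.IH[OF 2] set_pmf_sample_loop[OF 1] candidates_subset[of f M \<tau> A1 U1] by blast
qed auto

text \<open>Each threshold adds to \<open>B\<close> only the candidates left when its loop stopped,
  so at most \<open>(k + d) / \<epsilon>\<close> of them. The sampled elements are counted
  separately, by the rank.\<close>

lemma card_threshold_loop:
  assumes "(A', B') \<in> set_pmf (threshold_loop f M k d \<epsilon> l A B U)"
    and "finite U" "0 < real k + real d" "0 < \<epsilon>"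
  shows "real (card B') \<le> real (card B) + real (length l) * ((real k + real d) / \<epsilon>)"
  using assms
proof (induction l arbitrary: A B U)
  case (Cons \<tau> l)
  obtain A1 U1 where 1: "(A1, U1) \<in> set_pmf (sample_loop f M k d \<epsilon> \<tau> A U)"
    and 2: "(A', B') \<in> set_pmf (threshold_loop f M k d \<epsilon> l A1 (B \<union> candidates f M \<tau> A1 U1)
      (U1 - candidates f M \<tau> A1 U1))"
    using Cons.prems by (auto simp: Let_def)
  have "finite (U1 - candidates f M \<tau> A1 U1)"
    using set_pmf_sample_loop[OF 1] Cons.prems(2) finite_subset by blast
  from Cons.IH[OF 2 this Cons.prems(3,4)] card_candidates_sample_loop[OF 1 Cons.prems(2-)]
    card_Un_le[of B "candidates f M \<tau> A1 U1"]
  show ?case by (simp add: distrib_right add_divide_distrib)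
qed auto

section \<open>Submodular functions and matroids\<close>

locale submodular_matroid =
  fixes V :: "'a set" and f :: "'a set \<Rightarrow> real" and M :: "'a set set"
  assumes instance_ok: "matroid_submod_instance V f M"
begin

lemma finite_ground: "finite V"
  and indep_subset_ground: "X \<in> M \<Longrightarrow> X \<subseteq> V"
  and empty_indep: "{} \<in> M"
  and indep_subset: "X \<in> M \<Longrightarrow> Y \<subseteq> X \<Longrightarrow> Y \<in> M"
  and indep_exchange: "X \<in> M \<Longrightarrow> Y \<in> M \<Longrightarrow> card X < card Y \<Longrightarrow> \<exists>e\<in>Y - X. insert e X \<in> M"
  using instance_ok unfolding matroid_submod_instance_def matroid_def by blast+

lemma f_empty: "f {} = 0"
  and f_nonneg: "X \<subseteq> V \<Longrightarrow> 0 \<le> f X"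
  and f_submodular: "X \<subseteq> V \<Longrightarrow> Y \<subseteq> V \<Longrightarrow> f (X \<union> Y) + f (X \<inter> Y) \<le> f X + f Y"
  using instance_ok unfolding matroid_submod_instance_def submodular_on_def by blast+

lemma finite_subset_ground: "X \<subseteq> V \<Longrightarrow> finite X"
  using finite_ground finite_subset by blast

lemma finite_indep_sets: "finite M"
  using finite_ground indep_subset_ground by (meson Pow_iff finite_Pow_iff finite_subset subsetI)

lemma card_indep_le_rank: "X \<in> M \<Longrightarrow> card X \<le> matroid_rank M"
  unfolding matroid_rank_def using finite_indep_sets by (intro Max_ge) auto

lemma f_subadditive:
  assumes "X \<subseteq> V" "Y \<subseteq> V"
  shows "f (X \<union> Y) \<le> f X + f Y"
  using f_submodular[OF assms] f_nonneg[OF le_infI1[OF assms(1)], of Y] by linarith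

text \<open>Submodularity for \<open>X \<union> {e}\<close> and \<open>Y\<close>. The condition
  \<open>e \<notin> Y\<close> matters without monotonicity: otherwise the left side is 0, while the
  right side may be negative.\<close>

lemma marginal_antimono:
  assumes "X \<subseteq> Y" "Y \<subseteq> V" "e \<in> V" "e \<notin> Y"
  shows "marginal f {e} Y \<le> marginal f {e} X"
proof -
  have "f ((X \<union> {e}) \<union> Y) + f ((X \<union> {e}) \<inter> Y) \<le> f (X \<union> {e}) + f Y"
    using assms by (intro f_submodular) auto
  moreover have "(X \<union> {e}) \<union> Y = {e} \<union> Y" "(X \<union> {e}) \<inter> Y = X" "X \<union> {e} = {e} \<union> X"
    using assms by auto
  ultimately show ?thesis unfolding marginal_def by simp
qed

text \<open>Insert \<open>S\<close> one element at a time; each gain is at most the marginal over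
  the smaller set \<open>A\<close>. Allowing \<open>A\<close> below \<open>X\<close> makes it
  possible to add \<open>R \<inter> B\<close> first and still use marginals over
  \<open>A\<close>.\<close>

lemma f_Un_le_sum_marginals:
  assumes "A \<subseteq> X" "X \<subseteq> V" "S \<subseteq> V" "S \<inter> X = {}"
  shows "f (X \<union> S) \<le> f X + (\<Sum>e\<in>S. marginal f {e} A)"
proof -
  have "finite S" using assms finite_subset_ground by blast
  then show ?thesis using assms
  proof (induction S rule: finite_induct)
    case (insert e S)
    have "marginal f {e} (X \<union> S) \<le> marginal f {e} A"
      using insert by (intro marginal_antimono) auto
    then have "f (X \<union> insert e S) \<le> f (X \<union> S) + marginal f {e} A"
      by (simp add: marginal_def)
    with insert show ?case by simp
  qed simp
qed

text \<open>Sampling one element uniformly from \<open>C\<close> costs at most a \<open>1 / card C\<close> fraction of the value: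
  by submodularity the marginals sum to at least \<open>f (X \<union> C) - f X \<ge> - f X\<close>.\<close>

lemma sum_f_insert_ge:
  assumes "X \<subseteq> V" "C \<subseteq> V"
  shows "(real (card C) - 1) * f X \<le> (\<Sum>e\<in>C. f (X \<union> {e}))"
proof -
  have fin: "finite C" using assms finite_subset_ground by blast
  have "0 \<le> f (X \<union> (C - X))" using assms by (intro f_nonneg) auto
  also have "\<dots> \<le> f X + (\<Sum>e\<in>C - X. marginal f {e} X)"
    using assms by (intro f_Un_le_sum_marginals) auto
  also have "(\<Sum>e\<in>C - X. marginal f {e} X) = (\<Sum>e\<in>C. marginal f {e} X)"
    using fin by (intro sum.mono_neutral_left) (auto simp: marginal_def insert_absorb)
  finally show ?thesis
    by (simp add: marginal_def sum_subtractf algebra_simps)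
qed

lemma opt_value_ge:
  assumes "R \<in> M" "R \<subseteq> X"
  shows "f R \<le> opt_value f M X"
  unfolding opt_value_def using assms finite_indep_sets by (intro Max_ge) auto

lemma opt_value_attained:
  obtains R where "R \<in> M" "R \<subseteq> X" "f R = opt_value f M X"
proof -
  have "opt_value f M X \<in> f ` {R \<in> M. R \<subseteq> X}"
    unfolding opt_value_def using finite_indep_sets empty_indep by (intro Max_in) auto
  then show ?thesis using that by auto
qed

end

section \<open>Charging argument\<close>

locale robust_instance = submodular_matroid V f M
  for V :: "'a set" and f :: "'a set \<Rightarrow> real" and M :: "'a set set" +
  fixes \<epsilon> :: real and k d :: nat and D R :: "'a set"
  assumes eps: "0 < \<epsilon>" "\<epsilon> < 1"
    and rank: "matroid_rank M = k"
    and D: "card D \<le> d" "finite D"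
    and R: "R \<in> M"
begin

lemma card_indep_le: "X \<in> M \<Longrightarrow> card X \<le> k"
  using card_indep_le_rank rank by simp

definition blocked :: "'a set \<Rightarrow> 'a set \<Rightarrow> 'a set" where
  "blocked A U = {e \<in> R \<inter> U. A \<union> {e} \<notin> M}"

text \<open>The blocked elements form an independent set inside \<open>R\<close>. If there were more
  of them than elements of \<open>A\<close>, the exchange axiom would extend \<open>A\<close> by one
  of them.\<close>

lemma card_blocked_le:
  assumes "A \<in> M"
  shows "card (blocked A U) \<le> card A"
proof (rule ccontr)
  assume "\<not> ?thesis"
  moreover have "blocked A U \<in> M"
    by (rule indep_subset[OF R]) (auto simp: blocked_def)
  ultimately obtain e where "e \<in> blocked A U" "insert e A \<in> M"
    using indep_exchange[OF assms, of "blocked A U"] by auto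
  then show False by (auto simp: blocked_def)
qed

text \<open>Here \<open>s\<close> stands for the sum over the elements of \<open>A\<close> of the threshold at which they were
  sampled, and \<open>s'\<close> for the same sum over \<open>A - D\<close>; neither is part of the algorithm's state.
  The invariant holds inside the loop for \<open>\<tau>\<close> with \<open>v = \<tau>\<close> and \<open>w = (1 + \<epsilon>) * \<tau>\<close>, and after it
  with \<open>v = w = \<tau>\<close>. The bound on the blocked elements of \<open>R\<close> replaces an injective charging of them to
  \<open>A\<close>: the \<open>card A - card (blocked A U)\<close> elements not yet charged are kept as a credit.\<close>

definition charge_inv :: "real \<Rightarrow> real \<Rightarrow> real \<Rightarrow> real \<Rightarrow> 'a set \<Rightarrow> 'a set \<Rightarrow> bool" where
  "charge_inv v w s s' A U \<longleftrightarrow> A \<in> M \<and> U \<subseteq> V \<and> A \<inter> U = {} \<and>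
     f A \<le> (1 + \<epsilon>) * s \<and> s' \<le> f (A - D) \<and>
     (\<Sum>e\<in>blocked A U. marginal f {e} A) \<le>
       (1 + \<epsilon>) * s - (real (card A) - real (card (blocked A U))) * ((1 + \<epsilon>) * v) \<and>
     (\<forall>e\<in>U. A \<union> {e} \<in> M \<longrightarrow> marginal f {e} A \<le> w)"

text \<open>The credit is nonnegative by \<open>card_blocked_le\<close>, so lowering its unit price
  from \<open>(1 + \<epsilon>) * v\<close> to \<open>(1 + \<epsilon>) * \<tau>\<close> only weakens
  the bound on the blocked elements.\<close>

lemma charge_inv_enter:
  assumes "charge_inv v v s s' A U" "\<tau> \<le> v" "v \<le> (1 + \<epsilon>) * \<tau>"
  shows "charge_inv \<tau> ((1 + \<epsilon>) * \<tau>) s s' A U"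
proof -
  have "(real (card A) - real (card (blocked A U))) * ((1 + \<epsilon>) * \<tau>) \<le>
      (real (card A) - real (card (blocked A U))) * ((1 + \<epsilon>) * v)"
    using assms eps card_blocked_le[of A U] by (intro mult_left_mono) (auto simp: charge_inv_def)
  with assms show ?thesis by (fastforce simp: charge_inv_def)
qed

text \<open>A blocked element is never a candidate, so discarding the candidates leaves the charging
  untouched and pushes the remaining feasible marginals below \<open>\<tau>\<close>.\<close>

lemma charge_inv_exit:
  assumes "charge_inv \<tau> w s s' A U"
  shows "charge_inv \<tau> \<tau> s s' A (U - candidates f M \<tau> A U)"
proof -
  have "blocked A (U - candidates f M \<tau> A U) = blocked A U"
    by (auto simp: blocked_def candidates_def)
  with assms show ?thesis by (auto simp: charge_inv_def candidates_def)
qed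

text \<open>The sample raises \<open>(1 + \<epsilon>) * s\<close> by one unit
  \<open>(1 + \<epsilon>) * \<tau>\<close> and \<open>card A\<close> by one, so it brings one unit
  of credit. A newly blocked element was feasible before, so its marginal costs at most one unit,
  and it uses up one credit.\<close>

lemma charge_inv_step:
  assumes inv: "charge_inv \<tau> ((1 + \<epsilon>) * \<tau>) s s' A U" and e: "e \<in> candidates f M \<tau> A U"
  shows "charge_inv \<tau> ((1 + \<epsilon>) * \<tau>) (s + \<tau>) (s' + (if e \<in> D then 0 else \<tau>)) (A \<union> {e}) (U - {e})"
proof -
  let ?q = "1 + \<epsilon>"
  let ?K = "blocked A U" and ?K' = "blocked (A \<union> {e}) (U - {e})"
  have AM: "A \<in> M" and UV: "U \<subseteq> V" and AU: "A \<inter> U = {}" and fA: "f A \<le> ?q * s"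
    and s': "s' \<le> f (A - D)"
    and K: "(\<Sum>x\<in>?K. marginal f {x} A) \<le> ?q * s - (real (card A) - real (card ?K)) * (?q * \<tau>)"
    and marg: "\<And>x. x \<in> U \<Longrightarrow> A \<union> {x} \<in> M \<Longrightarrow> marginal f {x} A \<le> ?q * \<tau>"
    using inv by (auto simp: charge_inv_def)
  have eU: "e \<in> U" "e \<notin> A" "e \<in> V" and eM: "A \<union> {e} \<in> M" and et: "\<tau> \<le> marginal f {e} A"
    using e AU UV by (auto simp: candidates_def)
  have AV: "A \<subseteq> V" "A \<union> {e} \<subseteq> V" using AM eM indep_subset_ground by auto
  have finU: "finite U" using UV finite_subset_ground by blast
  have f1: "f (A \<union> {e}) \<le> ?q * (s + \<tau>)"
    using marg[OF eU(1) eM] fA by (simp add: marginal_def algebra_simps)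
  \<comment> \<open>An undeleted sample gains at least as much over \<open>A - D\<close> as over
    \<open>A\<close>, hence at least \<open>\<tau>\<close>; a deleted one leaves
    \<open>A - D\<close> unchanged.\<close>
  have f2: "s' + (if e \<in> D then 0 else \<tau>) \<le> f (A \<union> {e} - D)"
  proof (cases "e \<in> D")
    case False
    have "marginal f {e} A \<le> marginal f {e} (A - D)"
      using AV eU by (intro marginal_antimono) auto
    moreover have "A \<union> {e} - D = {e} \<union> (A - D)" using False by auto
    ultimately show ?thesis using s' et False by (simp add: marginal_def)
  qed (use s' in \<open>simp add: insert_Diff_if\<close>)
  \<comment> \<open>Blocked elements stay blocked as \<open>A\<close> grows, and the sample
    \<open>e\<close>, the only element leaving \<open>U\<close>, was feasible.\<close>
  have sub: "?K \<subseteq> ?K'"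
  proof
    fix x assume x: "x \<in> ?K"
    have "A \<union> {e} \<union> {x} \<notin> M"
      using indep_subset[of "A \<union> {e} \<union> {x}" "A \<union> {x}"] x by (auto simp: blocked_def)
    with x eM show "x \<in> ?K'" by (auto simp: blocked_def)
  qed
  have finK: "finite ?K'" using finU by (auto simp: blocked_def)
  have mono: "marginal f {x} (A \<union> {e}) \<le> marginal f {x} A" if "x \<in> ?K'" for x
    using that AV AU UV by (intro marginal_antimono) (auto simp: blocked_def)
  have "(\<Sum>x\<in>?K'. marginal f {x} (A \<union> {e})) \<le> (\<Sum>x\<in>?K'. marginal f {x} A)"
    by (intro sum_mono mono)
  also have "\<dots> = (\<Sum>x\<in>?K' - ?K. marginal f {x} A) + (\<Sum>x\<in>?K. marginal f {x} A)"
    by (rule sum.subset_diff[OF sub finK])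
  also have "(\<Sum>x\<in>?K' - ?K. marginal f {x} A) \<le> real (card (?K' - ?K)) * (?q * \<tau>)"
    by (rule sum_bounded_above) (auto simp: blocked_def intro!: marg)
  also have "real (card (?K' - ?K)) = real (card ?K') - real (card ?K)"
    using sub finK by (simp add: card_Diff_subset finite_subset card_mono of_nat_diff)
  finally have "(\<Sum>x\<in>?K'. marginal f {x} (A \<union> {e})) \<le>
      (real (card ?K') - real (card ?K)) * (?q * \<tau>) +
      (?q * s - (real (card A) - real (card ?K)) * (?q * \<tau>))"
    using K by linarith
  also have "\<dots> = ?q * (s + \<tau>) - (real (card (A \<union> {e})) - real (card ?K')) * (?q * \<tau>)"
    using eU AV(1) finite_subset_ground by (simp add: algebra_simps)
  finally have f3: "(\<Sum>x\<in>?K'. marginal f {x} (A \<union> {e})) \<le>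
    ?q * (s + \<tau>) - (real (card (A \<union> {e})) - real (card ?K')) * (?q * \<tau>)" .
  have f4: "marginal f {x} (A \<union> {e}) \<le> ?q * \<tau>" if "x \<in> U - {e}" "A \<union> {e} \<union> {x} \<in> M" for x
  proof -
    have "A \<union> {x} \<in> M" using indep_subset[OF that(2), of "A \<union> {x}"] by auto
    moreover have "marginal f {x} (A \<union> {e}) \<le> marginal f {x} A"
      using that AV AU UV by (intro marginal_antimono) auto
    ultimately show ?thesis using marg[of x] that by fastforce
  qed
  show ?thesis
    unfolding charge_inv_def using f1 f2 f3 f4 eM UV AU by auto
qed

text \<open>With this factor the potential \<open>2 * (1 + \<epsilon>) * s - \<kappa> * s'\<close> does not grow in expectation when a
  sample is deleted with probability at most \<open>\<epsilon>\<close>.\<close>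

definition \<kappa> :: real where "\<kappa> = 2 * (1 + \<epsilon>) / (1 - \<epsilon>)"

lemma \<kappa>_nonneg: "0 \<le> \<kappa>"
  using eps by (simp add: \<kappa>_def)

text \<open>The factor 2 has two sources: \<open>f A\<close> and the blocked part of
  \<open>R \<inter> U\<close> each cost at most \<open>(1 + \<epsilon>) * s\<close>. At most
  \<open>k\<close> unblocked elements remain, each of marginal at most \<open>v\<close>.
  Subadditivity splits off \<open>R \<inter> B\<close>.\<close>

lemma charge_inv_final:
  assumes inv: "charge_inv v v s s' A U" and v: "0 \<le> v"
    and B: "B \<subseteq> V" "B \<inter> U = {}" "R \<subseteq> A \<union> B \<union> U"
  shows "f (A \<union> R) - f (R \<inter> B) - \<kappa> * f (A - D) \<le> 2 * (1 + \<epsilon>) * s - \<kappa> * s' + real k * v"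
proof -
  let ?q = "1 + \<epsilon>" and ?K = "blocked A U"
  have AM: "A \<in> M" and UV: "U \<subseteq> V" and AU: "A \<inter> U = {}" and fA: "f A \<le> ?q * s"
    and s': "s' \<le> f (A - D)"
    and K: "(\<Sum>x\<in>?K. marginal f {x} A) \<le> ?q * s - (real (card A) - real (card ?K)) * (?q * v)"
    and marg: "\<And>x. x \<in> U \<Longrightarrow> A \<union> {x} \<in> M \<Longrightarrow> marginal f {x} A \<le> v"
    using inv by (auto simp: charge_inv_def)
  have AV: "A \<subseteq> V" and RV: "R \<subseteq> V" using AM R indep_subset_ground by auto
  have finR: "finite R" using RV finite_subset_ground by auto
  have "0 \<le> (real (card A) - real (card ?K)) * (?q * v)"
    using card_blocked_le[OF AM, of U] v eps by (intro mult_nonneg_nonneg) auto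
  then have blocked: "(\<Sum>x\<in>?K. marginal f {x} A) \<le> ?q * s" using K by linarith
  have "(\<Sum>x\<in>R \<inter> U - ?K. marginal f {x} A) \<le> real (card (R \<inter> U - ?K)) * v"
    by (rule sum_bounded_above) (auto simp: blocked_def intro!: marg)
  also have "\<dots> \<le> real k * v"
  proof (intro mult_right_mono v)
    have "card (R \<inter> U - ?K) \<le> card R" by (intro card_mono finR) auto
    then show "real (card (R \<inter> U - ?K)) \<le> real k" using card_indep_le[OF R] by linarith
  qed
  finally have unblocked: "(\<Sum>x\<in>R \<inter> U - ?K. marginal f {x} A) \<le> real k * v" .
  have "?K \<subseteq> R \<inter> U" by (auto simp: blocked_def)
  from sum.subset_diff[OF this, of "\<lambda>x. marginal f {x} A"]
  have "(\<Sum>x\<in>R \<inter> U. marginal f {x} A) \<le> ?q * s + real k * v"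
    using blocked unblocked finR by simp
  moreover have "f ((A \<union> (R \<inter> B)) \<union> (R \<inter> U)) \<le>
      f (A \<union> (R \<inter> B)) + (\<Sum>x\<in>R \<inter> U. marginal f {x} A)"
    using AV RV AU B by (intro f_Un_le_sum_marginals) auto
  moreover have "(A \<union> (R \<inter> B)) \<union> (R \<inter> U) = A \<union> R" using B by auto
  moreover have "f (A \<union> (R \<inter> B)) \<le> f A + f (R \<inter> B)"
    using AV RV by (intro f_subadditive) auto
  moreover have "\<kappa> * s' \<le> \<kappa> * f (A - D)"
    using s' \<kappa>_nonneg by (rule mult_left_mono)
  ultimately show ?thesis using fA by (simp add: algebra_simps)
qed

text \<open>The potential is a supermartingale, so a bound at the end of the loop carries over to
  its start. As \<open>s\<close> and \<open>s'\<close> are not determined by the output,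
  \<open>h\<close> has to be bounded for all values compatible with the invariant.\<close>

lemma expectation_sample_loop_le:
  fixes h :: "'a set \<times> 'a set \<Rightarrow> real"
  assumes "0 \<le> \<tau>" "charge_inv \<tau> ((1 + \<epsilon>) * \<tau>) s s' A U"
    and "\<And>s s' A' U'. charge_inv \<tau> ((1 + \<epsilon>) * \<tau>) s s' A' U' \<Longrightarrow> A' \<union> U' = A \<union> U \<Longrightarrow> U' \<subseteq> U \<Longrightarrow>
      h (A', U') \<le> 2 * (1 + \<epsilon>) * s - \<kappa> * s' + c"
  shows "measure_pmf.expectation (sample_loop f M k d \<epsilon> \<tau> A U) h \<le> 2 * (1 + \<epsilon>) * s - \<kappa> * s' + c"
  using assms(2-)
proof (induction "card U" arbitrary: s s' A U rule: less_induct)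
  case (less U s s' A)
  let ?C = "candidates f M \<tau> A U"
  let ?go = "finite U \<and> ?C \<noteq> {} \<and> real (card ?C) \<ge> (real k + real d) / \<epsilon>"
  let ?E = "\<lambda>e. measure_pmf.expectation (sample_loop f M k d \<epsilon> \<tau> (A \<union> {e}) (U - {e})) h"
  let ?b = "2 * (1 + \<epsilon>) * s - \<kappa> * s' + c"
  show ?case
  proof (cases ?go)
    case False
    then show ?thesis
      using less.prems(2)[OF less.prems(1)] by (subst sample_loop.simps) auto
  next
    case True
    have finC: "finite ?C" using True finite_candidates by blast
    have CU: "?C \<subseteq> U" by (rule candidates_subset)
    have n: "0 < real (card ?C)" using True finC by (simp add: card_gt_0_iff)
    have step: "?E e \<le> ?b + 2 * (1 + \<epsilon>) * \<tau> - (if e \<in> D then 0 else \<kappa> * \<tau>)" if e: "e \<in> ?C" for e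
    proof -
      have "?E e \<le> 2 * (1 + \<epsilon>) * (s + \<tau>) - \<kappa> * (s' + (if e \<in> D then 0 else \<tau>)) + c"
      proof (rule less.hyps)
        show "card (U - {e}) < card U" using True e CU by (intro card_Diff1_less) auto
        show "charge_inv \<tau> ((1 + \<epsilon>) * \<tau>) (s + \<tau>) (s' + (if e \<in> D then 0 else \<tau>)) (A \<union> {e}) (U - {e})"
          by (rule charge_inv_step[OF less.prems(1) e])
      next
        fix s2 s2' A2 U2
        assume "charge_inv \<tau> ((1 + \<epsilon>) * \<tau>) s2 s2' A2 U2" "A2 \<union> U2 = A \<union> {e} \<union> (U - {e})" "U2 \<subseteq> U - {e}"
        then show "h (A2, U2) \<le> 2 * (1 + \<epsilon>) * s2 - \<kappa> * s2' + c"
          using e CU by (intro less.prems(2)) auto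
      qed
      then show ?thesis by (simp add: algebra_simps split: if_splits)
    qed
    have "(\<Sum>e\<in>?C. if e \<in> D then 0 else \<kappa> * \<tau>) = (\<Sum>e\<in>?C. \<kappa> * \<tau>) - (\<Sum>e\<in>?C. if e \<in> D then \<kappa> * \<tau> else 0)"
      unfolding sum_subtractf[symmetric] by (intro sum.cong) auto
    also have "\<dots> = (real (card ?C) - real (card (?C \<inter> D))) * (\<kappa> * \<tau>)"
      using finC by (simp add: sum.If_cases left_diff_distrib Int_def)
    finally have cnt: "(\<Sum>e\<in>?C. if e \<in> D then 0 else \<kappa> * \<tau>) =
      (real (card ?C) - real (card (?C \<inter> D))) * (\<kappa> * \<tau>)" .
    have "real (card (?C \<inter> D)) \<le> real d"
      using card_mono[of D "?C \<inter> D"] D by simp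
    \<comment> \<open>The size test makes the candidates so numerous that at most an
      \<open>\<epsilon>\<close> fraction of them lies in \<open>D\<close>.\<close>
    moreover have "real k + real d \<le> \<epsilon> * real (card ?C)"
      using True eps by (simp add: field_simps)
    ultimately have "(1 - \<epsilon>) * real (card ?C) \<le> real (card ?C) - real (card (?C \<inter> D))"
      by (simp add: algebra_simps)
    moreover have "0 \<le> \<kappa> * \<tau>" using \<kappa>_nonneg assms(1) by simp
    ultimately have "(1 - \<epsilon>) * real (card ?C) * (\<kappa> * \<tau>) \<le> (\<Sum>e\<in>?C. if e \<in> D then 0 else \<kappa> * \<tau>)"
      unfolding cnt by (rule mult_right_mono)
    \<comment> \<open>The choice of \<open>\<kappa>\<close> makes the guaranteed decrease from
      surviving samples cancel the increase of \<open>2 * (1 + \<epsilon>) * s\<close>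
      exactly.\<close>
    moreover have "(1 - \<epsilon>) * real (card ?C) * (\<kappa> * \<tau>) = real (card ?C) * (2 * (1 + \<epsilon>) * \<tau>)"
      using eps by (simp add: \<kappa>_def)
    moreover have "(\<Sum>e\<in>?C. ?E e) \<le> (\<Sum>e\<in>?C. ?b + 2 * (1 + \<epsilon>) * \<tau> - (if e \<in> D then 0 else \<kappa> * \<tau>))"
      by (intro sum_mono step)
    ultimately have "(\<Sum>e\<in>?C. ?E e) \<le> real (card ?C) * ?b"
      by (simp add: sum_subtractf sum.distrib algebra_simps)
    then have "(\<Sum>e\<in>?C. ?E e) / real (card ?C) \<le> ?b"
      using n by (simp add: field_simps)
    moreover have "measure_pmf.expectation (sample_loop f M k d \<epsilon> \<tau> A U) h = (\<Sum>e\<in>?C. ?E e) / real (card ?C)"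
      using True finC
      by (subst sample_loop.simps) (auto intro!: expectation_bind_pmf_of_set_real finite_set_pmf_sample_loop)
    ultimately show ?thesis by simp
  qed
qed

lemma expectation_threshold_loop_Cons:
  fixes h :: "'a set \<times> 'a set \<Rightarrow> real"
  assumes "finite U"
  shows "measure_pmf.expectation (threshold_loop f M k d \<epsilon> (\<tau> # l) A B U) h =
    measure_pmf.expectation (sample_loop f M k d \<epsilon> \<tau> A U) (\<lambda>(A', U').
      measure_pmf.expectation (threshold_loop f M k d \<epsilon> l A' (B \<union> candidates f M \<tau> A' U')
        (U' - candidates f M \<tau> A' U')) h)"
proof -
  have "finite U'" if "(A', U') \<in> set_pmf (sample_loop f M k d \<epsilon> \<tau> A U)" for A' U'
    using set_pmf_sample_loop[OF that] assms finite_subset by blast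
  then have "measure_pmf.expectation (threshold_loop f M k d \<epsilon> (\<tau> # l) A B U) h =
    measure_pmf.expectation (sample_loop f M k d \<epsilon> \<tau> A U) (\<lambda>x. measure_pmf.expectation
      (case x of (A', U') \<Rightarrow> threshold_loop f M k d \<epsilon> l A' (B \<union> candidates f M \<tau> A' U')
        (U' - candidates f M \<tau> A' U')) h)"
    using assms unfolding threshold_loop.simps Let_def
    by (intro expectation_bind_finite finite_set_pmf_sample_loop)
      (auto intro!: finite_set_pmf_threshold_loop)
  also have "\<dots> = measure_pmf.expectation (sample_loop f M k d \<epsilon> \<tau> A U) (\<lambda>(A', U').
      measure_pmf.expectation (threshold_loop f M k d \<epsilon> l A' (B \<union> candidates f M \<tau> A' U')
        (U' - candidates f M \<tau> A' U')) h)"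
    by (simp add: case_prod_unfold)
  finally show ?thesis .
qed

text \<open>The level \<open>v\<close> reached so far is kept in front of the list. The first
  threshold then needs no special treatment, and \<open>last (v # l)\<close> is the final marginal
  bound even for an empty list.\<close>

lemma expectation_threshold_loop_le:
  assumes "successively (\<lambda>x y. y \<le> x \<and> x \<le> (1 + \<epsilon>) * y) (v # l)" "\<forall>x\<in>set (v # l). 0 \<le> x"
    and "charge_inv v v s s' A U" "B \<subseteq> V" "B \<inter> U = {}" "R \<subseteq> A \<union> B \<union> U"
  shows "measure_pmf.expectation (threshold_loop f M k d \<epsilon> l A B U)
      (\<lambda>(A, B). f (A \<union> R) - f (R \<inter> B) - \<kappa> * f (A - D))
    \<le> 2 * (1 + \<epsilon>) * s - \<kappa> * s' + real k * last (v # l)"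
  using assms
proof (induction l arbitrary: v s s' A B U)
  case Nil
  then show ?case using charge_inv_final by simp
next
  case (Cons \<tau> l)
  have UV: "U \<subseteq> V" using Cons.prems by (auto simp: charge_inv_def)
  have fin: "finite U" using UV finite_subset_ground by blast
  have enter: "charge_inv \<tau> ((1 + \<epsilon>) * \<tau>) s s' A U"
    using Cons.prems by (intro charge_inv_enter) auto
  have tail: "successively (\<lambda>x y. y \<le> x \<and> x \<le> (1 + \<epsilon>) * y) (\<tau> # l)" "\<forall>x\<in>set (\<tau> # l). 0 \<le> x"
    using Cons.prems by auto
  have "measure_pmf.expectation (threshold_loop f M k d \<epsilon> l A2 (B \<union> candidates f M \<tau> A2 U2)
        (U2 - candidates f M \<tau> A2 U2)) (\<lambda>(A, B). f (A \<union> R) - f (R \<inter> B) - \<kappa> * f (A - D))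
      \<le> 2 * (1 + \<epsilon>) * s2 - \<kappa> * s2' + real k * last (\<tau> # l)"
    if "charge_inv \<tau> ((1 + \<epsilon>) * \<tau>) s2 s2' A2 U2" "A2 \<union> U2 = A \<union> U" "U2 \<subseteq> U" for s2 s2' A2 U2
  proof (rule Cons.IH[OF tail charge_inv_exit[OF that(1)]])
    show "B \<union> candidates f M \<tau> A2 U2 \<subseteq> V" "(B \<union> candidates f M \<tau> A2 U2) \<inter> (U2 - candidates f M \<tau> A2 U2) = {}"
      "R \<subseteq> A2 \<union> (B \<union> candidates f M \<tau> A2 U2) \<union> (U2 - candidates f M \<tau> A2 U2)"
      using that Cons.prems UV by (auto simp: candidates_def)
  qed
  then have "measure_pmf.expectation (threshold_loop f M k d \<epsilon> (\<tau> # l) A B U)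
      (\<lambda>(A, B). f (A \<union> R) - f (R \<inter> B) - \<kappa> * f (A - D))
    \<le> 2 * (1 + \<epsilon>) * s - \<kappa> * s' + real k * last (\<tau> # l)"
    unfolding expectation_threshold_loop_Cons[OF fin]
    using tail by (intro expectation_sample_loop_le[OF _ enter]) auto
  then show ?case by simp
qed

section \<open>Lower bound on the expected value of \<open>f (A \<union> R)\<close>\<close>

definition hit_prob :: real where "hit_prob = \<epsilon> / (real k + real d)"

text \<open>\<open>hit_prob\<close> bounds the probability that one sample picks a given element,
  since there are at least \<open>(k + d) / \<epsilon>\<close> candidates; the at most
  \<open>k\<close> samples together contribute at most \<open>\<epsilon>\<close>.\<close>

lemma rank_hit_prob_le: "real k * hit_prob \<le> \<epsilon>"
  using eps by (cases "k = 0") (auto simp: hit_prob_def field_simps)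

lemma hit_prob_nonneg: "0 \<le> hit_prob"
  using eps by (auto simp: hit_prob_def)

text \<open>By \<open>sum_f_insert_ge\<close>, each sample keeps at least a fraction
  \<open>1 - hit_prob\<close> of \<open>f (A \<union> R)\<close> in expectation. The linear factor
  is the Bernoulli lower bound for the product over the \<open>k - card A\<close> samples that can
  still follow.\<close>

lemma expectation_sample_loop_ge:
  fixes h :: "'a set \<times> 'a set \<Rightarrow> real"
  assumes "A \<in> M" "U \<subseteq> V" "A \<inter> U = {}"
    and "\<And>A' U'. A' \<in> M \<Longrightarrow> U' \<subseteq> V \<Longrightarrow> A' \<inter> U' = {} \<Longrightarrow>
      (1 - (real k - real (card A')) * hit_prob) * f (A' \<union> R) \<le> h (A', U')"
  shows "(1 - (real k - real (card A)) * hit_prob) * f (A \<union> R) \<le>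
    measure_pmf.expectation (sample_loop f M k d \<epsilon> \<tau> A U) h"
  using assms
proof (induction "card U" arbitrary: A U rule: less_induct)
  case (less U A)
  let ?C = "candidates f M \<tau> A U" and ?p = hit_prob
  let ?go = "finite U \<and> ?C \<noteq> {} \<and> real (card ?C) \<ge> (real k + real d) / \<epsilon>"
  let ?E = "\<lambda>e. measure_pmf.expectation (sample_loop f M k d \<epsilon> \<tau> (A \<union> {e}) (U - {e})) h"
  show ?case
  proof (cases ?go)
    case False
    then show ?thesis
      using less.prems by (subst sample_loop.simps) auto
  next
    case True
    have finC: "finite ?C" using True finite_candidates by blast
    have CU: "?C \<subseteq> U" by (rule candidates_subset)
    have n: "0 < real (card ?C)" using True finC by (simp add: card_gt_0_iff)
    have AR: "A \<union> R \<subseteq> V" using less.prems R indep_subset_ground by auto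
    have finA: "finite A" using AR finite_subset_ground by auto
    let ?c = "1 - (real k - real (card A) - 1) * ?p"
    have step: "?c * f ((A \<union> R) \<union> {e}) \<le> ?E e" if e: "e \<in> ?C" for e
    proof -
      have eA: "A \<union> {e} \<in> M" "e \<in> U" "e \<notin> A" using e less.prems by (auto simp: candidates_def)
      have "(1 - (real k - real (card (A \<union> {e}))) * ?p) * f (A \<union> {e} \<union> R) \<le> ?E e"
      proof (rule less.hyps)
        show "card (U - {e}) < card U" using True e CU by (intro card_Diff1_less) auto
      qed (use eA less.prems in auto)
      moreover have "A \<union> {e} \<union> R = (A \<union> R) \<union> {e}" by auto
      ultimately show ?thesis using eA finA by (simp add: algebra_simps)
    qed
    obtain e where "e \<in> ?C" using True by auto
    then have "A \<union> {e} \<in> M" "e \<notin> A" using less.prems by (auto simp: candidates_def)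
    \<comment> \<open>A candidate extends \<open>A\<close> independently, so the rank leaves room
      for one more sample; this also excludes a zero denominator in \<open>hit_prob\<close>.\<close>
    then have cA: "card A + 1 \<le> k" using card_indep_le[of "A \<union> {e}"] finA by simp
    then have kd: "0 < real k + real d" by simp
    have "(real k - real (card A) - 1) * ?p \<le> real k * ?p"
      using hit_prob_nonneg by (intro mult_right_mono) auto
    then have c: "0 \<le> ?c" using rank_hit_prob_le eps by linarith
    have "real k + real d \<le> \<epsilon> * real (card ?C)"
      using True eps by (simp add: field_simps)
    then have "1 \<le> ?p * real (card ?C)"
      using kd by (simp add: hit_prob_def field_simps)
    then have "real (card ?C) * (1 - ?p) \<le> real (card ?C) - 1" by (simp add: algebra_simps)
    then have "real (card ?C) * (1 - ?p) * f (A \<union> R) \<le> (real (card ?C) - 1) * f (A \<union> R)"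
      using f_nonneg[OF AR] by (rule mult_right_mono)
    also have "\<dots> \<le> (\<Sum>e\<in>?C. f ((A \<union> R) \<union> {e}))"
      using AR CU less.prems by (intro sum_f_insert_ge) auto
    finally have "?c * (real (card ?C) * (1 - ?p) * f (A \<union> R)) \<le> (\<Sum>e\<in>?C. ?c * f ((A \<union> R) \<union> {e}))"
      unfolding sum_distrib_left[symmetric] by (rule mult_left_mono) (rule c)
    also have "\<dots> \<le> (\<Sum>e\<in>?C. ?E e)" by (intro sum_mono step)
    finally have "?c * (1 - ?p) * f (A \<union> R) \<le> (\<Sum>e\<in>?C. ?E e) / real (card ?C)"
      using n by (simp add: field_simps)
    moreover have "(1 - (real k - real (card A)) * ?p) * f (A \<union> R) \<le> ?c * (1 - ?p) * f (A \<union> R)"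
    proof (rule mult_right_mono[OF _ f_nonneg[OF AR]])
      \<comment> \<open>This is the quadratic term by which the product on the right exceeds the
        linear factor on the left.\<close>
      have "0 \<le> (real k - real (card A) - 1) * (?p * ?p)"
        using cA hit_prob_nonneg by (intro mult_nonneg_nonneg) auto
      then show "1 - (real k - real (card A)) * ?p \<le> ?c * (1 - ?p)" by (simp add: algebra_simps)
    qed
    moreover have "measure_pmf.expectation (sample_loop f M k d \<epsilon> \<tau> A U) h = (\<Sum>e\<in>?C. ?E e) / real (card ?C)"
      using True finC
      by (subst sample_loop.simps) (auto intro!: expectation_bind_pmf_of_set_real finite_set_pmf_sample_loop)
    ultimately show ?thesis by linarith
  qed
qed

lemma expectation_threshold_loop_ge:
  assumes "A \<in> M" "U \<subseteq> V" "A \<inter> U = {}"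
  shows "(1 - (real k - real (card A)) * hit_prob) * f (A \<union> R) \<le>
    measure_pmf.expectation (threshold_loop f M k d \<epsilon> l A B U) (\<lambda>(A, B). f (A \<union> R))"
  using assms
proof (induction l arbitrary: A B U)
  case Nil
  have "A \<union> R \<subseteq> V" using Nil.prems R indep_subset_ground by auto
  moreover have "0 \<le> (real k - real (card A)) * hit_prob"
    using card_indep_le[OF Nil.prems(1)] hit_prob_nonneg by (intro mult_nonneg_nonneg) auto
  ultimately show ?case
    using f_nonneg[of "A \<union> R"] mult_right_mono[of "1 - (real k - real (card A)) * hit_prob" 1 "f (A \<union> R)"]
    by simp
next
  case (Cons \<tau> l)
  have fin: "finite U" using Cons.prems finite_subset_ground by blast
  show ?case
    unfolding expectation_threshold_loop_Cons[OF fin]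
    using Cons.prems
    by (intro expectation_sample_loop_ge) (auto intro!: Cons.IH)
qed

end

section \<open>Thresholds\<close>

lemma length_filter_ge_nth:
  fixes xs :: "'b::linorder list"
  assumes "sorted_wrt (\<ge>) xs" "d < length xs"
  shows "d < length (filter (\<lambda>x. xs ! d \<le> x) xs)"
proof -
  have "filter (\<lambda>x. xs ! d \<le> x) (take (Suc d) xs) = take (Suc d) xs"
  proof (rule filter_True, rule ballI)
    fix x assume "x \<in> set (take (Suc d) xs)"
    then obtain i where "i < Suc d" "x = xs ! i" using assms by (auto simp: in_set_conv_nth)
    then show "xs ! d \<le> x"
      using assms sorted_wrt_nth_less[OF assms(1), of i d] by (cases "i = d") auto
  qed
  then have "length (filter (\<lambda>x. xs ! d \<le> x) (take (Suc d) xs @ drop (Suc d) xs)) \<ge> Suc d"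
    using assms unfolding filter_append by simp
  then show ?thesis by simp
qed

lemma length_filter_gt_nth:
  fixes xs :: "'b::linorder list"
  assumes "sorted_wrt (\<ge>) xs" "d < length xs"
  shows "length (filter (\<lambda>x. xs ! d < x) xs) \<le> d"
proof -
  have "filter (\<lambda>x. xs ! d < x) (drop d xs) = []"
  proof (rule filter_False, rule ballI)
    fix x assume "x \<in> set (drop d xs)"
    then obtain i where "i < length xs - d" "x = xs ! (d + i)" using assms by (auto simp: in_set_conv_nth)
    then show "\<not> xs ! d < x"
      using assms sorted_wrt_nth_less[OF assms(1), of d "d + i"] by (cases "i = 0") (auto simp: not_less)
  qed
  then have "length (filter (\<lambda>x. xs ! d < x) (take d xs @ drop d xs)) \<le> d"
    using length_filter_le[of "\<lambda>x. xs ! d < x" "take d xs"] assms unfolding filter_append by simp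
  then show ?thesis by simp
qed

text \<open>These two counts are all that is used of the sorted list: more than \<open>d\<close>
  elements reach the value, so one survives every deletion, and at most \<open>d\<close> exceed it.
  Ties are the reason for inequalities.\<close>

lemma nth_largest_value_card:
  assumes "d < card N"
  shows "d < card {e \<in> N. nth_largest_value f N d \<le> f {e}}"
    and "card {e \<in> N. nth_largest_value f N d < f {e}} \<le> d"
proof -
  let ?m = "image_mset (\<lambda>e. f {e}) (mset_set N)"
  let ?xs = "rev (sorted_list_of_multiset ?m)"
  have fin: "finite N" using assms card.infinite by force
  have mset: "mset ?xs = ?m" by simp
  have card: "card {e \<in> N. P (f {e})} = length (filter P ?xs)" for P
  proof -
    have "length (filter P ?xs) = size (filter_mset P (mset ?xs))"
      by (metis mset_filter size_mset)
    also have "\<dots> = size (image_mset (\<lambda>e. f {e}) (filter_mset (\<lambda>e. P (f {e})) (mset_set N)))"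
      unfolding mset by (simp add: filter_mset_image_mset)
    also have "\<dots> = card {e \<in> N. P (f {e})}" using fin by simp
    finally show ?thesis by simp
  qed
  have len: "length ?xs = card N" using mset by (metis size_mset size_image_mset size_mset_set)
  have sorted: "sorted_wrt (\<ge>) ?xs" by (simp add: sorted_wrt_rev sorted_sorted_list_of_multiset)
  have val: "nth_largest_value f N d = ?xs ! d" using assms by (simp add: nth_largest_value_def)
  show "d < card {e \<in> N. nth_largest_value f N d \<le> f {e}}"
    unfolding val card using sorted assms len by (intro length_filter_ge_nth) auto
  show "card {e \<in> N. nth_largest_value f N d < f {e}} \<le> d"
    unfolding val card using sorted assms len by (intro length_filter_gt_nth) auto
qed

text \<open>If \<open>e\<close> exceeded the value, so would all \<open>d\<close> elements of
  \<open>Vd\<close>, giving \<open>d + 1\<close> such elements.\<close>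

lemma value_le_nth_largest_value:
  assumes "top_elements f N d Vd" "finite N" "e \<in> N - Vd"
  shows "f {e} \<le> nth_largest_value f N d"
proof (rule ccontr)
  assume less: "\<not> ?thesis"
  have sub: "Vd \<subseteq> N" and card: "card Vd = min d (card N)"
    and top: "\<And>x. x \<in> Vd \<Longrightarrow> f {e} \<le> f {x}"
    using assms by (auto simp: top_elements_def)
  have "Vd \<subset> N" using assms sub by auto
  then have "card Vd < card N" using assms psubset_card_mono by blast
  then have d: "card Vd = d" "d < card N" using card by auto
  have "nth_largest_value f N d < f {x}" if "x \<in> insert e Vd" for x
    using that less top[of x] by (elim insertE) auto
  then have "insert e Vd \<subseteq> {x \<in> N. nth_largest_value f N d < f {x}}"
    using assms(3) sub by blast
  then have "card (insert e Vd) \<le> card {x \<in> N. nth_largest_value f N d < f {x}}"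
    using assms(2) by (intro card_mono) auto
  also have "\<dots> \<le> d" by (rule nth_largest_value_card(2)[OF d(2)])
  finally have "card (insert e Vd) \<le> d" .
  moreover have "card (insert e Vd) = Suc d"
    using assms sub d finite_subset[OF sub] by simp
  ultimately show False by simp
qed

section \<open>The geometric grid of thresholds\<close>

lemma successively_upto: "successively (\<lambda>i j. j = i + 1) [a..b]"
proof (induction a b rule: upto.induct)
  case (1 a b)
  show ?case
  proof (cases "a \<le> b")
    case True
    have "hd [a + 1..b] = a + 1" if "[a + 1..b] \<noteq> []"
      using that by (subst upto.simps) (auto split: if_splits)
    with 1[OF True] show ?thesis
      by (subst upto.simps) (auto simp: True successively_Cons)
  qed simp
qed

lemma thresholds_nonpos:
  assumes "\<Delta> \<le> 0" "0 < \<epsilon>"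
  shows "thresholds \<epsilon> k \<Delta> = {}"
proof -
  have "0 < (1 + \<epsilon>) powi i" for i using assms by simp
  then have "\<not> (1 + \<epsilon>) powi i \<le> \<Delta>" for i using assms by (meson not_le order_le_less_trans)
  then show ?thesis by (auto simp: thresholds_def)
qed

lemma thresholds_powi:
  fixes \<epsilon> \<Delta> :: real and k :: nat
  assumes "0 < \<epsilon>" "\<epsilon> < 1" "0 < \<Delta>" "0 < k"
  obtains lo hi :: int where "lo \<le> hi"
    "rev (sorted_list_of_set (thresholds \<epsilon> k \<Delta>)) = rev (map (\<lambda>i. (1 + \<epsilon>) powi i) [lo..hi])"
    "(1 + \<epsilon>) powi hi \<le> \<Delta>" "\<Delta> \<le> (1 + \<epsilon>) * (1 + \<epsilon>) powi hi"
    "real k * (1 + \<epsilon>) powi lo \<le> \<epsilon> * \<Delta>"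
    "real_of_int (hi - lo) \<le> 1 + ln (real k / \<epsilon>) / ln (1 + \<epsilon>)"
proof -
  define q where "q = 1 + \<epsilon>"
  define L where "L = \<epsilon> * \<Delta> / (q * real k)"
  have q: "1 < q" using assms by (simp add: q_def)
  have L: "0 < L" using assms q by (simp add: L_def)
  have pw: "q powi i = q powr real_of_int i" for i :: int
    using q by (simp add: powr_real_of_int')
  define hi where "hi = \<lfloor>log q \<Delta>\<rfloor>"
  \<comment> \<open>The lower bound on thresholds is strict and the upper one is not, hence the
    \<open>+ 1\<close> here and none in \<open>hi\<close>.\<close>
  define lo where "lo = \<lfloor>log q L\<rfloor> + 1"
  have le_iff: "q powi i \<le> \<Delta> \<longleftrightarrow> i \<le> hi" for i
    using q assms by (simp add: pw hi_def le_floor_iff le_log_iff)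
  have gt_iff: "L < q powi i \<longleftrightarrow> lo \<le> i" for i
    using q L by (simp add: pw lo_def log_less_iff[symmetric] floor_less_iff[symmetric] add1_zle_eq)
  have T: "thresholds \<epsilon> k \<Delta> = (\<lambda>i. q powi i) ` set [lo..hi]"
    unfolding thresholds_def q_def[symmetric] L_def[symmetric] using le_iff gt_iff by auto
  have ratio: "log q \<Delta> - log q L = 1 + ln (real k / \<epsilon>) / ln q"
  proof -
    have "log q \<Delta> - log q L = log q (\<Delta> / L)" using assms L q by (simp add: log_divide)
    also have "\<Delta> / L = q * (real k / \<epsilon>)" using assms q by (simp add: L_def)
    also have "log q \<dots> = 1 + log q (real k / \<epsilon>)" using assms q by (subst log_mult) auto
    finally show ?thesis by (simp add: log_def)
  qed
  have "0 \<le> ln (real k / \<epsilon>)" using assms by (intro ln_ge_zero) (simp add: field_simps)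
  then have "0 \<le> ln (real k / \<epsilon>) / ln q" using q by simp
  \<comment> \<open>The two logarithms differ by at least 1, so the half-open interval between them
    contains an integer.\<close>
  then have lohi: "lo \<le> hi" using ratio unfolding lo_def hi_def by linarith
  have mono: "q powi i < q powi j" if "i < j" for i j :: int
    using that q by (simp add: pw)
  have "sorted_wrt (<) (map (\<lambda>i. q powi i) [lo..hi])"
    unfolding sorted_wrt_map by (rule sorted_wrt_mono_rel[OF _ sorted_wrt_upto]) (use mono in auto)
  then have "sorted_list_of_set (thresholds \<epsilon> k \<Delta>) = map (\<lambda>i. q powi i) [lo..hi]"
    unfolding T set_map[symmetric]
    by (intro sorted_list_of_set.idem_if_sorted_distinct) (auto simp: strict_sorted_iff)
  moreover have "q powi hi \<le> \<Delta>" using le_iff by simp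
  moreover have "\<Delta> \<le> q * q powi hi"
    using le_iff[of "hi + 1"] q by (simp add: power_int_add mult.commute)
  moreover have "real k * q powi lo \<le> \<epsilon> * \<Delta>"
  proof -
    \<comment> \<open>The exponent \<open>lo - 1\<close> misses the strict bound, and the factor
      \<open>1 + \<epsilon>\<close> in the denominator of \<open>L\<close> makes up for the extra
      factor \<open>q\<close>.\<close>
    have "q powi lo = q * q powi (lo - 1)" using q by (simp add: power_int_diff)
    also have "\<dots> \<le> q * L" using gt_iff[of "lo - 1"] q by simp
    finally show ?thesis using assms q by (simp add: L_def field_simps)
  qed
  moreover have "real_of_int (hi - lo) \<le> 1 + ln (real k / \<epsilon>) / ln q"
    using ratio unfolding lo_def hi_def by linarith
  ultimately show ?thesis using that lohi unfolding q_def by blast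
qed

lemma thresholds_chain:
  fixes \<epsilon> \<Delta> :: real and k :: nat
  assumes "0 < \<epsilon>" "\<epsilon> < 1" "0 \<le> \<Delta>" "k = 0 \<Longrightarrow> \<Delta> = 0"
  defines "l \<equiv> rev (sorted_list_of_set (thresholds \<epsilon> k \<Delta>))"
  shows "successively (\<lambda>x y. y \<le> x \<and> x \<le> (1 + \<epsilon>) * y) (\<Delta> # l)" (is ?chain)
    and "\<forall>x\<in>set (\<Delta> # l). 0 \<le> x" (is ?nonneg)
    and "real k * last (\<Delta> # l) \<le> \<epsilon> * \<Delta>" (is ?last)
    and "0 < k \<Longrightarrow> real (length l) \<le> 2 + 2 * ln (real k / \<epsilon>) / \<epsilon>"
proof -
  have "?chain \<and> ?nonneg \<and> ?last \<and> (0 < k \<longrightarrow> real (length l) \<le> 2 + 2 * ln (real k / \<epsilon>) / \<epsilon>)"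
  proof (cases "\<Delta> = 0")
    case True
    then have "l = []" using assms by (simp add: l_def thresholds_nonpos)
    moreover have "0 \<le> ln (real k / \<epsilon>)" if "0 < k"
      using assms that by (intro ln_ge_zero) (simp add: field_simps)
    ultimately show ?thesis using True assms by auto
  next
    case False
    then have pos: "0 < \<Delta>" "0 < k" using assms by auto
    obtain lo hi where lohi: "lo \<le> hi" and l: "l = rev (map (\<lambda>i. (1 + \<epsilon>) powi i) [lo..hi])"
      and hi: "(1 + \<epsilon>) powi hi \<le> \<Delta>" "\<Delta> \<le> (1 + \<epsilon>) * (1 + \<epsilon>) powi hi"
      and lo: "real k * (1 + \<epsilon>) powi lo \<le> \<epsilon> * \<Delta>"
      and len: "real_of_int (hi - lo) \<le> 1 + ln (real k / \<epsilon>) / ln (1 + \<epsilon>)"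
      using thresholds_powi[OF assms(1,2) pos] unfolding l_def by blast
    have ne: "[lo..hi] \<noteq> []" using lohi by (simp add: upto.simps)
    have hd: "hd l = (1 + \<epsilon>) powi hi"
      using lohi ne by (simp add: l hd_rev last_map upto_rec2)
    have last: "last l = (1 + \<epsilon>) powi lo"
      using lohi ne by (simp add: l last_rev hd_map upto_rec1)
    have "successively (\<lambda>x y. y \<le> x \<and> x \<le> (1 + \<epsilon>) * y) l"
      unfolding l successively_rev successively_map
    proof (rule successively_mono[OF successively_upto])
      fix i j :: int assume "j = i + 1"
      then have "(1 + \<epsilon>) powi j = (1 + \<epsilon>) * (1 + \<epsilon>) powi i"
        using assms by (simp add: power_int_add mult.commute)
      moreover have "0 \<le> (1 + \<epsilon>) powi i" using assms by simp
      ultimately show "(1 + \<epsilon>) powi i \<le> (1 + \<epsilon>) powi j \<and> (1 + \<epsilon>) powi j \<le> (1 + \<epsilon>) * (1 + \<epsilon>) powi i"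
        using assms by (simp add: distrib_right)
    qed
    moreover have "real (length l) \<le> 2 + 2 * ln (real k / \<epsilon>) / \<epsilon>"
    proof -
      \<comment> \<open>The estimate \<open>ln x \<le> x - 1\<close> at
        \<open>1 / (1 + \<epsilon>)\<close> yields
        \<open>ln (1 + \<epsilon>) \<ge> \<epsilon> / 2\<close>, which trades the base of the
        logarithm for a factor \<open>2 / \<epsilon>\<close>.\<close>
      have "\<epsilon> / 2 \<le> \<epsilon> / (1 + \<epsilon>)" using assms by (simp add: field_simps)
      also have "\<dots> \<le> ln (1 + \<epsilon>)"
        using ln_le_minus_one[of "1 / (1 + \<epsilon>)"] assms by (simp add: ln_div field_simps)
      finally have ln: "\<epsilon> / 2 \<le> ln (1 + \<epsilon>)" .
      have "0 \<le> ln (real k / \<epsilon>)"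
        using assms pos by (intro ln_ge_zero) (simp add: field_simps)
      then have "ln (real k / \<epsilon>) / ln (1 + \<epsilon>) \<le> ln (real k / \<epsilon>) / (\<epsilon> / 2)"
        using ln assms by (intro divide_left_mono) auto
      moreover have "real (length l) = real_of_int (hi - lo) + 1" using lohi by (simp add: l)
      ultimately show ?thesis using len by (simp add: mult.commute)
    qed
    moreover have "l \<noteq> []" using ne by (simp add: l)
    moreover have "0 \<le> x" if "x \<in> set l" for x using that assms(1) by (auto simp: l)
    ultimately show ?thesis
      using hi lo hd last pos by (simp add: successively_Cons)
  qed
  then show ?chain ?nonneg ?last "0 < k \<Longrightarrow> real (length l) \<le> 2 + 2 * ln (real k / \<epsilon>) / \<epsilon>"
    by auto
qed

section \<open>Approximation ratio and summary size\<close>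

context submodular_matroid
begin

lemma nonloops_subset: "nonloops V M \<subseteq> V"
  by (auto simp: nonloops_def)

lemma finite_nonloops: "finite (nonloops V M)"
  using nonloops_subset finite_subset_ground by blast

lemma indep_subset_nonloops: "X \<in> M \<Longrightarrow> X \<subseteq> nonloops V M"
  using indep_subset indep_subset_ground by (fastforce simp: nonloops_def)

lemma nonloops_rank_0: "matroid_rank M = 0 \<Longrightarrow> nonloops V M = {}"
  using card_indep_le_rank by (fastforce simp: nonloops_def)

lemma nth_largest_value_nonneg: "0 \<le> nth_largest_value f (nonloops V M) d"
proof (cases "d < card (nonloops V M)")
  case True
  let ?N = "nonloops V M" and ?\<Delta> = "nth_largest_value f (nonloops V M) d"
  have "card {e \<in> ?N. ?\<Delta> < f {e}} < card ?N"
    using nth_largest_value_card(2)[OF True, of f] True by linarith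
  then have "{e \<in> ?N. ?\<Delta> < f {e}} \<noteq> ?N" by auto
  then obtain e where "e \<in> ?N" "f {e} \<le> ?\<Delta>" by fastforce
  then show ?thesis using f_nonneg[of "{e}"] nonloops_subset by fastforce
qed (simp add: nth_largest_value_def)

text \<open>\<open>D\<close> is too small to contain all nonloops of value at least the
  \<open>(d + 1)\<close>-th largest, and a surviving one is itself a feasible solution.\<close>

lemma nth_largest_value_le_opt:
  assumes "card D \<le> d" "finite D"
  shows "nth_largest_value f (nonloops V M) d \<le> opt_value f M (V - D)"
proof (cases "d < card (nonloops V M)")
  case True
  let ?N = "nonloops V M" and ?\<Delta> = "nth_largest_value f (nonloops V M) d"
  have "card D < card {e \<in> ?N. ?\<Delta> \<le> f {e}}"
    using nth_largest_value_card(1)[OF True, of f] assms by linarith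
  then have "\<not> {e \<in> ?N. ?\<Delta> \<le> f {e}} \<subseteq> D"
    using card_mono[OF assms(2)] by (meson not_le)
  then obtain e where "e \<in> ?N" "?\<Delta> \<le> f {e}" "e \<notin> D" by auto
  moreover from this have "f {e} \<le> opt_value f M (V - D)"
    by (intro opt_value_ge) (auto simp: nonloops_def)
  ultimately show ?thesis by linarith
next
  case False
  then show ?thesis
    using opt_value_ge[of "{}" "V - D"] empty_indep f_empty by (simp add: nth_largest_value_def)
qed

lemma phase1_support:
  assumes "(A, B) \<in> set_pmf (phase1 \<epsilon> k d (nonloops V M) f M Vd)"
    "top_elements f (nonloops V M) d Vd"
  shows "A \<in> M" "A \<union> B \<subseteq> V"
proof -
  have "Vd \<subseteq> V" using assms(2) nonloops_subset by (auto simp: top_elements_def)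
  with set_pmf_threshold_loop[OF assms(1)[unfolded phase1_def]] empty_indep nonloops_subset
  show "A \<in> M" "A \<union> B \<subseteq> V" by auto
qed

lemma finite_set_pmf_phase1: "finite (set_pmf (phase1 \<epsilon> k d (nonloops V M) f M Vd))"
  unfolding phase1_def using finite_nonloops by (intro finite_set_pmf_threshold_loop) auto

section \<open>Guarantees of the second phase\<close>

context
  fixes Alg :: "'a centralized_alg" and \<beta> :: real and A B D :: "'a set"
  assumes Alg: "centralized_approx \<beta> Alg" and A: "A \<in> M" and AB: "A \<union> B \<subseteq> V"
begin

lemma alg_support: "S \<in> set_pmf (Alg ((A - D) \<union> (B - D)) f M) \<Longrightarrow> S \<subseteq> (A - D) \<union> (B - D) \<and> S \<in> M"
  and alg_value: "1 / \<beta> * opt_value f M ((A - D) \<union> (B - D)) \<le>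
    measure_pmf.expectation (Alg ((A - D) \<union> (B - D)) f M) f"
proof -
  have "(A - D) \<union> (B - D) \<subseteq> V" using AB by auto
  then show "S \<in> set_pmf (Alg ((A - D) \<union> (B - D)) f M) \<Longrightarrow> S \<subseteq> (A - D) \<union> (B - D) \<and> S \<in> M"
    and "1 / \<beta> * opt_value f M ((A - D) \<union> (B - D)) \<le>
    measure_pmf.expectation (Alg ((A - D) \<union> (B - D)) f M) f"
    using Alg instance_ok unfolding centralized_approx_def by blast+
qed

lemma finite_set_pmf_alg: "finite (set_pmf (Alg ((A - D) \<union> (B - D)) f M))"
  using alg_support finite_indep_sets by (meson finite_subset subsetI)

lemma phase2_support:
  assumes "S \<in> set_pmf (phase2 Alg f M A B D)"
  shows "S \<subseteq> (A \<union> B) - D \<and> S \<in> M"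
proof -
  obtain T where "T \<in> set_pmf (Alg ((A - D) \<union> (B - D)) f M)" "S = A - D \<or> S = T"
    using assms unfolding phase2_def by (auto split: if_splits)
  then show ?thesis using alg_support[of T] indep_subset[OF A, of "A - D"] by blast
qed

lemma finite_set_pmf_phase2: "finite (set_pmf (phase2 Alg f M A B D))"
  unfolding phase2_def using finite_set_pmf_alg by simp

lemma phase2_ge_remaining: "f (A - D) \<le> measure_pmf.expectation (phase2 Alg f M A B D) f"
  by (rule le_expectation_finite[OF finite_set_pmf_phase2]) (auto simp: phase2_def)

text \<open>As \<open>R\<close> avoids \<open>D\<close>, the set \<open>R \<inter> B\<close> is
  feasible for \<open>Alg\<close>, and the second phase returns nothing worse than the output of
  \<open>Alg\<close>.\<close>

lemma phase2_ge_opt: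
  assumes "0 < \<beta>" "R \<in> M" "R \<inter> D = {}"
  shows "f (R \<inter> B) \<le> \<beta> * measure_pmf.expectation (phase2 Alg f M A B D) f"
proof -
  have "f (R \<inter> B) \<le> opt_value f M ((A - D) \<union> (B - D))"
    using assms indep_subset[of R "R \<inter> B"] by (intro opt_value_ge) auto
  also have "\<dots> \<le> \<beta> * measure_pmf.expectation (Alg ((A - D) \<union> (B - D)) f M) f"
    using alg_value assms by (simp add: field_simps)
  also have "\<dots> \<le> \<beta> * measure_pmf.expectation (phase2 Alg f M A B D) f"
    unfolding phase2_def integral_map_pmf
    using assms by (intro mult_left_mono expectation_mono_finite finite_set_pmf_alg) auto
  finally show ?thesis .
qed

end

lemma robust_approximation:
  assumes eps5: "0 < \<epsilon>" "\<epsilon> < 1 / 5" and beta: "0 < \<beta>" and Alg: "centralized_approx \<beta> Alg"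
    and rank: "matroid_rank M = k" and top: "top_elements f (nonloops V M) d Vd"
    and del: "D \<subseteq> V" "card D \<le> d"
  shows "opt_value f M (V - D) \<le> (2 + \<beta> + (20 + 4 * \<beta>) * \<epsilon>) *
    measure_pmf.expectation (bind_pmf (phase1 \<epsilon> k d (nonloops V M) f M Vd)
      (\<lambda>(A, B). phase2 Alg f M A B D)) f"
proof -
  obtain R where opt: "R \<in> M" "R \<subseteq> V - D" "f R = opt_value f M (V - D)"
    using opt_value_attained .
  have finD: "finite D" using del finite_subset_ground by blast
  interpret robust_instance V f M \<epsilon> k d D R
    by unfold_locales (use eps5 rank del finD opt in auto)
  let ?N = "nonloops V M" and ?opt = "opt_value f M (V - D)"
  let ?\<Delta> = "nth_largest_value f ?N d"
  let ?P = "phase1 \<epsilon> k d ?N f M Vd" and ?E2 = "\<lambda>(A, B). measure_pmf.expectation (phase2 Alg f M A B D) f"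
  let ?E = "measure_pmf.expectation (bind_pmf ?P (\<lambda>(A, B). phase2 Alg f M A B D)) f"
  let ?Y = "\<lambda>(A, B). f (A \<union> R) - f (R \<inter> B) - \<kappa> * f (A - D)"
  have VdN: "Vd \<subseteq> ?N" using top by (simp add: top_elements_def)
  have RN: "R \<subseteq> ?N" using opt indep_subset_nonloops by blast
  have \<Delta>0: "0 \<le> ?\<Delta>" by (rule nth_largest_value_nonneg)
  have \<Delta>k: "k = 0 \<Longrightarrow> ?\<Delta> = 0"
    using nonloops_rank_0 rank by (simp add: nth_largest_value_def)
  have eps1: "\<epsilon> < 1" using eps5 by simp
  \<comment> \<open>Nonloops are feasible for the empty set, so the invariant starts with no charge,
    and the choice of \<open>Vd\<close> bounds the remaining marginals.\<close>
  have blocked: "blocked {} (?N - Vd) = {}" by (auto simp: blocked_def nonloops_def)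
  have "charge_inv ?\<Delta> ?\<Delta> 0 0 {} (?N - Vd)"
    unfolding charge_inv_def blocked
    using empty_indep f_empty nonloops_subset value_le_nth_largest_value[OF top finite_nonloops]
    by (auto simp: marginal_def)
  then have "measure_pmf.expectation ?P ?Y \<le> 2 * (1 + \<epsilon>) * 0 - \<kappa> * 0 +
      real k * last (?\<Delta> # rev (sorted_list_of_set (thresholds \<epsilon> k ?\<Delta>)))"
    unfolding phase1_def
    using VdN nonloops_subset RN
    by (intro expectation_threshold_loop_le[OF thresholds_chain(1,2)[OF eps5(1) eps1 \<Delta>0 \<Delta>k]]) auto
  also have "\<dots> \<le> \<epsilon> * ?\<Delta>" using thresholds_chain(3)[OF eps5(1) eps1 \<Delta>0 \<Delta>k] by simp
  also have "\<dots> \<le> \<epsilon> * ?opt"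
    using nth_largest_value_le_opt[OF del(2) finD] eps by (intro mult_left_mono) auto
  finally have Y: "measure_pmf.expectation ?P ?Y \<le> \<epsilon> * ?opt" .
  have opt0: "0 \<le> ?opt" using opt f_nonneg[of R] by auto
  have "(1 - \<epsilon>) * ?opt \<le> (1 - (real k - real (card ({} :: 'a set))) * hit_prob) * f ({} \<union> R)"
    using rank_hit_prob_le opt0 opt by (auto intro!: mult_right_mono)
  also have "\<dots> \<le> measure_pmf.expectation ?P (\<lambda>(A, B). f (A \<union> R))"
    unfolding phase1_def using empty_indep nonloops_subset
    by (intro expectation_threshold_loop_ge) auto
  also have "\<dots> \<le> measure_pmf.expectation ?P (\<lambda>x. ?Y x + (\<kappa> + \<beta>) * ?E2 x)"
  proof (rule expectation_mono_finite[OF finite_set_pmf_phase1])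
    fix x assume "x \<in> set_pmf ?P"
    moreover obtain A B where x: "x = (A, B)" by fastforce
    ultimately have AB: "A \<in> M" "A \<union> B \<subseteq> V" using phase1_support[OF _ top] by auto
    have "\<kappa> * f (A - D) \<le> \<kappa> * ?E2 (A, B)"
      using phase2_ge_remaining[OF Alg AB, of D] \<kappa>_nonneg by (simp add: mult_left_mono)
    moreover have "f (R \<inter> B) \<le> \<beta> * ?E2 (A, B)"
      using phase2_ge_opt[OF Alg AB beta opt(1)] opt(2) by auto
    ultimately show "(case x of (A, B) \<Rightarrow> f (A \<union> R)) \<le> ?Y x + (\<kappa> + \<beta>) * ?E2 x"
      by (simp add: x algebra_simps)
  qed
  also have "\<dots> = measure_pmf.expectation ?P ?Y + (\<kappa> + \<beta>) * measure_pmf.expectation ?P ?E2"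
    by (simp add: integrable_measure_pmf_finite finite_set_pmf_phase1)
  also have "measure_pmf.expectation ?P ?E2 = ?E"
  proof -
    have "?E = measure_pmf.expectation ?P (\<lambda>x. measure_pmf.expectation
        (case x of (A, B) \<Rightarrow> phase2 Alg f M A B D) f)"
      using finite_set_pmf_phase2[OF Alg phase1_support[OF _ top]]
      by (intro expectation_bind_finite finite_set_pmf_phase1) auto
    then show ?thesis by (simp add: case_prod_unfold)
  qed
  \<comment> \<open>One \<open>\<epsilon>\<close> is lost to the samples spoiling \<open>R\<close>,
    the other to marginals below the smallest threshold.\<close>
  finally have main: "(1 - 2 * \<epsilon>) * ?opt \<le> (\<kappa> + \<beta>) * ?E"
    using Y by (simp add: algebra_simps)
  have "0 \<le> ?E"
  proof (rule integral_nonneg_AE, unfold AE_measure_pmf_iff, clarsimp)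
    fix A B S assume "(A, B) \<in> set_pmf ?P" "S \<in> set_pmf (phase2 Alg f M A B D)"
    then show "0 \<le> f S"
      using phase2_support[OF Alg phase1_support[OF _ top]] f_nonneg indep_subset_ground by blast
  qed
  moreover have "\<kappa> + \<beta> \<le> (1 - 2 * \<epsilon>) * (2 + \<beta> + (20 + 4 * \<beta>) * \<epsilon>)"
  proof -
    \<comment> \<open>This is equivalent to \<open>5 * \<epsilon>\<^sup>2 \<le> \<epsilon>\<close>,
      which is where \<open>\<epsilon> < 1 / 5\<close> enters.\<close>
    have "\<kappa> \<le> 2 + 5 * \<epsilon>"
      using eps5 mult_left_mono[of "5 * \<epsilon>" 1 \<epsilon>] by (simp add: \<kappa>_def field_simps)
    \<comment> \<open>The product is exactly the claimed right side minus
      \<open>2 + \<beta> + 5 * \<epsilon>\<close>; the constant \<open>20 + 4 * \<beta>\<close> is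
      large enough to make it nonnegative.\<close>
    moreover have "0 \<le> \<epsilon> * ((20 + 4 * \<beta>) * (1 / 5 - \<epsilon>) * 2 + 3 + 2 / 5 * \<beta>)"
      using eps5 beta by (intro mult_nonneg_nonneg add_nonneg_nonneg) auto
    ultimately show ?thesis by (simp add: algebra_simps)
  qed
  ultimately have "(1 - 2 * \<epsilon>) * ?opt \<le> (1 - 2 * \<epsilon>) * (2 + \<beta> + (20 + 4 * \<beta>) * \<epsilon>) * ?E"
    using main mult_right_mono order_trans by blast
  then show ?thesis using eps5 by (simp add: mult.assoc)
qed

lemma summary_size:
  assumes eps: "0 < \<epsilon>" "\<epsilon> < 1 / 5" and rank: "matroid_rank M = k"
    and top: "top_elements f (nonloops V M) d Vd"
    and AB: "(A, B) \<in> set_pmf (phase1 \<epsilon> k d (nonloops V M) f M Vd)"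
  shows "real (card (A \<union> B)) \<le> 5 * ((real k + real d) / \<epsilon>\<^sup>2 * ln (real k / \<epsilon>))"
proof (cases "k = 0")
  case True
  \<comment> \<open>In rank 0 the bound itself is 0 because \<open>ln 0 = 0\<close>, so the summary
    must be shown empty.\<close>
  then have "nonloops V M = {}" using nonloops_rank_0 rank by simp
  then have "A = {}" "B = {}"
    using AB top eps by (auto simp: phase1_def top_elements_def nth_largest_value_def thresholds_nonpos)
  then show ?thesis using True by simp
next
  case False
  let ?N = "nonloops V M" and ?L = "ln (real k / \<epsilon>)"
  let ?l = "rev (sorted_list_of_set (thresholds \<epsilon> k (nth_largest_value f ?N d)))"
  have eps1: "\<epsilon> < 1" using eps by simp
  have len: "real (length ?l) \<le> 2 + 2 * ?L / \<epsilon>"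
    by (rule thresholds_chain(4)) (use eps eps1 nth_largest_value_nonneg False in auto)
  \<comment> \<open>The logarithm is at least 1, so it absorbs the lower-order terms:
    \<open>\<epsilon>\<^sup>2 + 2 * \<epsilon>\<close> costs 3, which with the leading 2 gives
    5.\<close>
  have "5 \<le> real k / \<epsilon>" using eps False by (simp add: field_simps)
  then have "exp 1 \<le> real k / \<epsilon>" using exp_le by linarith
  then have L: "1 \<le> ?L" using eps False by (subst ln_ge_iff) auto
  have kd: "0 < real k + real d" using False by simp
  have "real (card B) \<le> real (card Vd) + real (length ?l) * ((real k + real d) / \<epsilon>)"
    using finite_nonloops kd eps
    by (intro card_threshold_loop[OF AB[unfolded phase1_def]]) auto
  moreover have "card Vd \<le> d" using top by (simp add: top_elements_def)
  moreover have "card A \<le> k" using phase1_support[OF AB top] card_indep_le_rank rank by blast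
  moreover have "card (A \<union> B) \<le> card A + card B" by (rule card_Un_le)
  moreover have "real (length ?l) * ((real k + real d) / \<epsilon>) \<le>
      (2 + 2 * ?L / \<epsilon>) * ((real k + real d) / \<epsilon>)"
    using len eps kd by (intro mult_right_mono) auto
  ultimately have "real (card (A \<union> B)) \<le>
      (real k + real d) + (2 + 2 * ?L / \<epsilon>) * ((real k + real d) / \<epsilon>)"
    by linarith
  also have "\<dots> = (real k + real d) * (1 + (2 + 2 * ?L / \<epsilon>) / \<epsilon>)"
    by (simp add: algebra_simps add_divide_distrib)
  also have "\<dots> \<le> (real k + real d) * (5 * ?L / \<epsilon>\<^sup>2)"
  proof (rule mult_left_mono)
    have "\<epsilon>\<^sup>2 + 2 * \<epsilon> \<le> 3 * ?L" using eps L mult_mono[of \<epsilon> 1 \<epsilon> 1] by (simp add: power2_eq_square)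
    then have "(\<epsilon>\<^sup>2 + 2 * \<epsilon> + 2 * ?L) / \<epsilon>\<^sup>2 \<le> 5 * ?L / \<epsilon>\<^sup>2"
      by (intro divide_right_mono) auto
    moreover have "1 + (2 + 2 * ?L / \<epsilon>) / \<epsilon> = (\<epsilon>\<^sup>2 + 2 * \<epsilon> + 2 * ?L) / \<epsilon>\<^sup>2"
      using eps by (simp add: add_divide_distrib power2_eq_square)
    ultimately show "1 + (2 + 2 * ?L / \<epsilon>) / \<epsilon> \<le> 5 * ?L / \<epsilon>\<^sup>2" by simp
  qed (use kd in simp)
  finally show ?thesis by (simp add: field_simps)
qed

end

theorem theorem2:
  shows "\<exists>c>0. \<forall>\<beta>>0. \<exists>C>0.
    \<forall>\<epsilon> (Alg :: 'a centralized_alg) V f M k d Vd.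
      0 < \<epsilon> \<longrightarrow> \<epsilon> < 1 / 5 \<longrightarrow>
      centralized_approx \<beta> Alg \<longrightarrow>
      matroid_submod_instance V f M \<longrightarrow> matroid_rank M = k \<longrightarrow>
      top_elements f (nonloops V M) d Vd \<longrightarrow>
        deletion_robust_approx V f M d (2 + \<beta> + C * \<epsilon>)
          (phase1 \<epsilon> k d (nonloops V M) f M Vd) (phase2 Alg f M) \<and>
        (\<forall>(A, B)\<in>set_pmf (phase1 \<epsilon> k d (nonloops V M) f M Vd).
          real (card (A \<union> B)) \<le> c * ((real k + real d) / \<epsilon>\<^sup>2 * ln (real k / \<epsilon>)))"
proof (rule exI[of _ 5], intro conjI allI impI)
  fix \<beta> :: real assume \<beta>: "0 < \<beta>"
  show "\<exists>C>0. \<forall>\<epsilon> (Alg :: 'a centralized_alg) V f M k d Vd.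
      0 < \<epsilon> \<longrightarrow> \<epsilon> < 1 / 5 \<longrightarrow>
      centralized_approx \<beta> Alg \<longrightarrow>
      matroid_submod_instance V f M \<longrightarrow> matroid_rank M = k \<longrightarrow>
      top_elements f (nonloops V M) d Vd \<longrightarrow>
        deletion_robust_approx V f M d (2 + \<beta> + C * \<epsilon>)
          (phase1 \<epsilon> k d (nonloops V M) f M Vd) (phase2 Alg f M) \<and>
        (\<forall>(A, B)\<in>set_pmf (phase1 \<epsilon> k d (nonloops V M) f M Vd).
          real (card (A \<union> B)) \<le> 5 * ((real k + real d) / \<epsilon>\<^sup>2 * ln (real k / \<epsilon>)))"
  proof (rule exI[of _ "20 + 4 * \<beta>"], intro conjI allI impI)
    show "0 < 20 + 4 * \<beta>" using \<beta> by simp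
  next
    fix \<epsilon> :: real and Alg :: "'a centralized_alg" and V f and M :: "'a set set" and k d Vd
    assume eps: "0 < \<epsilon>" "\<epsilon> < 1 / 5" and Alg: "centralized_approx \<beta> Alg"
      and inst: "matroid_submod_instance V f M" and rank: "matroid_rank M = k"
      and top: "top_elements f (nonloops V M) d Vd"
    interpret submodular_matroid V f M by unfold_locales (rule inst)
    note supp = phase1_support[OF _ top]
    show "deletion_robust_approx V f M d (2 + \<beta> + (20 + 4 * \<beta>) * \<epsilon>)
        (phase1 \<epsilon> k d (nonloops V M) f M Vd) (phase2 Alg f M)"
      unfolding deletion_robust_approx_def
    proof (intro conjI allI impI ballI)
      fix x assume "x \<in> set_pmf (phase1 \<epsilon> k d (nonloops V M) f M Vd)"
      then show "case x of (A, B) \<Rightarrow> A \<union> B \<subseteq> V" using supp(2) by (cases x) simp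
    next
      fix D x assume "x \<in> set_pmf (phase1 \<epsilon> k d (nonloops V M) f M Vd)"
      then show "case x of (A, B) \<Rightarrow> \<forall>S\<in>set_pmf (phase2 Alg f M A B D). S \<subseteq> A \<union> B - D \<and> S \<in> M"
        using phase2_support[OF Alg supp] by (cases x) simp
    next
      fix D assume "D \<subseteq> V" "card D \<le> d"
      then show "opt_value f M (V - D) \<le> (2 + \<beta> + (20 + 4 * \<beta>) * \<epsilon>) *
        measure_pmf.expectation (bind_pmf (phase1 \<epsilon> k d (nonloops V M) f M Vd)
          (\<lambda>(A, B). phase2 Alg f M A B D)) f"
        by (rule robust_approximation[OF eps \<beta> Alg rank top])
    qed
    show "\<forall>(A, B)\<in>set_pmf (phase1 \<epsilon> k d (nonloops V M) f M Vd).
        real (card (A \<union> B)) \<le> 5 * ((real k + real d) / \<epsilon>\<^sup>2 * ln (real k / \<epsilon>))"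
      using summary_size[OF eps rank top] by blast
  qed
qed simp

end
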